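(* Let $n\ge 2$ be an integer. Then there exist constants $\gamma>0$, $C>0$ and $Q_0>1$, depending on $n$ only, such that for every real $Q\ge Q_0$ and every real $v$ with $0\le v\le n-1$ one has $$\#\mathcal{D}_{n,\gamma}(Q,v)\ \ge\ C\,Q^{\,n+1-\frac{n+2}{n}v}.$$
   Context: For a polynomial $P=a_nx^n+\dots+a_0\in\mathbb{Z}[x]$ of degree $n$, $H(P)=\max_{0\le i\le n}|a_i|$ is its (naive) height, and for real $Q>1$ $$\mathcal{P}_n(Q)=\{P\in\mathbb{Z}[x]:\deg P=n,\ H(P)\le Q\}$$ (degree exactly $n$). The discriminant is $D(P)=a_n^{2n-2}\prod_{1\le i<j\le n}(\alpha_i-\alpha_j)^2$, where $\alpha_1,\dots,\alpha_n\in\mathbb{C}$ are the roots of $P$ (with multiplicity); it is an integer. For $\gamma>0$ define $$\mathcal{D}_{n,\gamma}(Q,v)=\{P\in\mathcal{P}_n(Q):1\le|D(P)|\le\gamma\,Q^{2n-2-2v}\}.$$ *)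

theory Defs
  imports Complex_Main "HOL-Computational_Algebra.Computational_Algebra"
    "HOL-Combinatorics.Combinatorics"
begin

definition height :: "int poly \<Rightarrow> int" where
  "height P = Max ((\<lambda>i. \<bar>coeff P i\<bar>) ` {..degree P})"

definition int_polys :: "nat \<Rightarrow> real \<Rightarrow> int poly set" where
  "int_polys n Q = {P. degree P = n \<and> real_of_int (height P) \<le> Q}"

text \<open>
  The roots are taken in \<open>\<complex>\<close> with multiplicity; for \<open>n \<ge> 1\<close> the enumeration has length \<open>n\<close>.
  Lemma \<open>poly_discr_eq\<close> below shows that its choice is immaterial.
\<close>
definition poly_discr :: "int poly \<Rightarrow> complex" where
  "poly_discr P =
     (let n = degree P; \<alpha> = (SOME \<alpha>. mset \<alpha> = proots (map_poly of_int P :: complex poly))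
      in of_int (lead_coeff P) ^ (2 * n - 2) * (\<Prod>j<n. \<Prod>i<j. (\<alpha> ! i - \<alpha> ! j)\<^sup>2))"

text \<open>
  The discriminant is an integer, so its absolute value is the complex norm of \<^const>\<open>poly_discr\<close>.
\<close>
definition discr_polys :: "nat \<Rightarrow> real \<Rightarrow> real \<Rightarrow> real \<Rightarrow> int poly set" where
  "discr_polys n \<gamma> Q v =
     {P \<in> int_polys n Q. 1 \<le> norm (poly_discr P) \<and>
        norm (poly_discr P) \<le> \<gamma> * Q powr (2 * real n - 2 - 2 * v)}"


lemma prod_pairs_square_eq:
  fixes f :: "nat \<Rightarrow> complex"
  shows "(\<Prod>j<n. \<Prod>i<j. (f i - f j)\<^sup>2) =
           (\<Prod>j<n. \<Prod>i<j. - 1) * (\<Prod>j<n. \<Prod>i\<in>{..<n} - {j}. f i - f j)"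
proof (induction n)
  case (Suc n)
  have "(\<Prod>j<Suc n. \<Prod>i\<in>{..<Suc n} - {j}. f i - f j) =
          (\<Prod>j<n. \<Prod>i\<in>{..<Suc n} - {j}. f i - f j) * (\<Prod>i<n. f i - f n)"
    by (simp add: lessThan_Suc)
  also have "(\<Prod>j<n. \<Prod>i\<in>{..<Suc n} - {j}. f i - f j) =
          (\<Prod>j<n. (f n - f j) * (\<Prod>i\<in>{..<n} - {j}. f i - f j))"
  proof (rule prod.cong)
    fix j assume "j \<in> {..<n}"
    hence "{..<Suc n} - {j} = insert n ({..<n} - {j})"
      by auto
    thus "(\<Prod>i\<in>{..<Suc n} - {j}. f i - f j) = (f n - f j) * (\<Prod>i\<in>{..<n} - {j}. f i - f j)"
      by simp
  qed simp
  finally have *: "(\<Prod>j<Suc n. \<Prod>i\<in>{..<Suc n} - {j}. f i - f j) =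
      (\<Prod>j<n. f n - f j) * (\<Prod>j<n. \<Prod>i\<in>{..<n} - {j}. f i - f j) * (\<Prod>i<n. f i - f n)"
    by (simp add: prod.distrib)
  have "(\<Prod>i<n. (f i - f n)\<^sup>2) = (\<Prod>i<n. (- 1) * ((f n - f i) * (f i - f n)))"
    by (rule prod.cong) (simp_all add: power2_eq_square algebra_simps)
  also have "\<dots> = (\<Prod>i<n. - 1) * (\<Prod>j<n. f n - f j) * (\<Prod>i<n. f i - f n)"
    by (simp only: prod.distrib mult.assoc)
  finally have "(\<Prod>j<Suc n. \<Prod>i<j. (f i - f j)\<^sup>2) =
      (\<Prod>j<n. \<Prod>i<j. - 1) * (\<Prod>j<n. \<Prod>i\<in>{..<n} - {j}. f i - f j) *
      ((\<Prod>i<n. - 1) * (\<Prod>j<n. f n - f j) * (\<Prod>i<n. f i - f n))"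
    by (simp only: prod.lessThan_Suc[of _ n] Suc.IH)
  also have "\<dots> = ((\<Prod>j<n. \<Prod>i<j. - 1) * (\<Prod>i<n. - 1)) *
      (\<Prod>j<Suc n. \<Prod>i\<in>{..<Suc n} - {j}. f i - f j)"
    unfolding * by (simp only: mult_ac)
  finally show ?case
    by (simp only: prod.lessThan_Suc[of "\<lambda>j. \<Prod>i<j. - 1" n])
qed simp

lemma prod_pairs_square_mset_cong:
  fixes xs ys :: "complex list"
  assumes "mset xs = mset ys" and "length xs = n"
  shows "(\<Prod>j<n. \<Prod>i<j. (xs ! i - xs ! j)\<^sup>2) = (\<Prod>j<n. \<Prod>i<j. (ys ! i - ys ! j)\<^sup>2)"
proof -
  have len: "length ys = n"
    using assms by (metis mset_eq_length)
  obtain p where p: "p permutes {..<length ys}" "permute_list p ys = xs"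
    using mset_eq_permutation[OF assms(1)] by blast
  have bij: "bij_betw p {..<n} {..<n}"
    using p(1) len by (simp add: permutes_imp_bij)
  have nth: "xs ! i = ys ! p i" if "i < n" for i
    using that p len permute_list_nth[OF p(1)] by auto
  have "(\<Prod>j<n. \<Prod>i\<in>{..<n} - {j}. xs ! i - xs ! j) =
          (\<Prod>j<n. \<Prod>i\<in>{..<n} - {p j}. ys ! i - ys ! p j)"
  proof (rule prod.cong[OF refl])
    fix j assume j: "j \<in> {..<n}"
    have "bij_betw p ({..<n} - {j}) ({..<n} - {p j})"
      using bij j by (auto simp: bij_betw_def inj_on_def)
    note reindex = prod.reindex_bij_betw[OF this, of "\<lambda>i. ys ! i - ys ! p j"]
    have "(\<Prod>i\<in>{..<n} - {j}. xs ! i - xs ! j) = (\<Prod>i\<in>{..<n} - {j}. ys ! p i - ys ! p j)"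
      by (rule prod.cong[OF refl]) (use j nth in auto)
    thus "(\<Prod>i\<in>{..<n} - {j}. xs ! i - xs ! j) =
            (\<Prod>i\<in>{..<n} - {p j}. ys ! i - ys ! p j)"
      using reindex by simp
  qed
  also have "\<dots> = (\<Prod>j<n. \<Prod>i\<in>{..<n} - {j}. ys ! i - ys ! j)"
    using prod.reindex_bij_betw[OF bij, of "\<lambda>j. \<Prod>i\<in>{..<n} - {j}. ys ! i - ys ! j"] .
  finally show ?thesis
    unfolding prod_pairs_square_eq by simp
qed

lemma poly_discr_eq:
  assumes "mset \<alpha> = proots (map_poly of_int P :: complex poly)" and "degree P = n"
  shows "poly_discr P =
           of_int (lead_coeff P) ^ (2 * n - 2) * (\<Prod>j<n. \<Prod>i<j. (\<alpha> ! i - \<alpha> ! j)\<^sup>2)"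
proof -
  define \<beta> where "\<beta> = (SOME \<alpha>. mset \<alpha> = proots (map_poly of_int P :: complex poly))"
  have \<beta>: "mset \<beta> = proots (map_poly of_int P :: complex poly)"
    unfolding \<beta>_def by (rule someI) (rule assms(1))
  have "length \<beta> = size (proots (map_poly of_int P :: complex poly))"
    by (metis \<beta> size_mset)
  hence "length \<beta> = n"
    using assms(2) by (simp add: size_proots_complex degree_map_poly)
  hence "(\<Prod>j<n. \<Prod>i<j. (\<beta> ! i - \<beta> ! j)\<^sup>2) = (\<Prod>j<n. \<Prod>i<j. (\<alpha> ! i - \<alpha> ! j)\<^sup>2)"
    using \<beta> assms(1) by (intro prod_pairs_square_mset_cong) simp_all
  thus ?thesis
    unfolding poly_discr_def Let_def \<beta>_def[symmetric] using assms(2) by simp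
qed

lemma finite_int_polys: "finite (int_polys n Q)"
proof (rule finite_subset)
  let ?L = "{xs. set xs \<subseteq> {-\<lfloor>Q\<rfloor>..\<lfloor>Q\<rfloor>} \<and> length xs = Suc n}"
  show "finite (Poly ` ?L)"
    by (intro finite_imageI finite_lists_length_eq) simp
  show "int_polys n Q \<subseteq> Poly ` ?L"
  proof
    fix P assume P: "P \<in> int_polys n Q"
    have "\<bar>coeff P i\<bar> \<le> \<lfloor>Q\<rfloor>" if "i \<le> n" for i
    proof -
      have "\<bar>coeff P i\<bar> \<le> height P"
        unfolding height_def using P that by (intro Max_ge) (auto simp: int_polys_def)
      also have "\<dots> \<le> \<lfloor>Q\<rfloor>"
        using P by (simp add: int_polys_def le_floor_iff)
      finally show ?thesis .
    qed
    hence "map (coeff P) [0..<Suc n] \<in> ?L"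
      by (auto simp: abs_le_iff minus_le_iff less_Suc_eq_le)
    moreover have "P = Poly (map (coeff P) [0..<Suc n])"
    proof (rule poly_eqI)
      fix i
      show "coeff P i = coeff (Poly (map (coeff P) [0..<Suc n])) i"
        using P by (cases "i \<le> n")
          (auto simp: nth_default_def int_polys_def coeff_eq_0 simp del: upt_Suc)
    qed
    ultimately show "P \<in> Poly ` ?L"
      by blast
  qed
qed

lemma finite_discr_polys: "finite (discr_polys n \<gamma> Q v)"
  unfolding discr_polys_def by (rule finite_subset[OF _ finite_int_polys]) blast

end

theory Submission
  imports Defs
begin

text \<open>
  The discriminant of a binary form of degree \<open>n\<close> is invariant under unimodular substitutions,
  while the height grows by the factor \<open>N ^ n\<close> (up to a constant) when the matrix has entries of
  size \<open>N\<close>. Substituting matrices \<open>(a, b; c, d)\<close> of determinant 1 and size \<open>N\<close> into integer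
  polynomials of height about \<open>m\<close> therefore gives polynomials of height about \<open>m * N ^ n\<close> whose
  discriminants are only of size \<open>m ^ (2 * n - 2)\<close>. With \<open>N\<close> about \<open>Q powr (v / (n * (n - 1)))\<close> and
  \<open>m\<close> about \<open>Q / N ^ n\<close> this is exactly the range of height and discriminant in the theorem.
  There are about \<open>N\<^sup>2\<close> possible bottom rows \<open>(c, d)\<close> and \<open>m ^ (n + 1)\<close> polynomials, and
  \<open>N\<^sup>2 * m ^ (n + 1)\<close> has the order \<open>Q powr (n + 1 - (n + 2) / n * v)\<close>. It remains to see that the
  substituted polynomials are essentially distinct and have discriminant at least 1.

  \<^emph>\<open>Distinctness.\<close> The polynomials that are substituted into are small perturbations of multiples
  of \<open>x\<^sup>2 + 4\<close>, so that each has a root \<open>\<alpha>\<close> near \<open>2 * \<i>\<close>, with imaginary part greater than 1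
  (\<open>near_quadratic_high_root\<close>). The corresponding root \<open>w\<close> of the substituted polynomial satisfies
  \<open>(norm (c * w + d))\<^sup>2 < Im w\<close> (\<open>moebius_high_root\<close>), and at most one pair of coprime positive
  integers \<open>(c, d)\<close> can do that for a given \<open>w\<close> (\<open>high_orbit_point_unique\<close>); this is the
  familiar fact that a horoball of height 1 at infinity is disjoint from its other translates under
  the modular group. As one matrix is fixed for each bottom row, a polynomial arises at most once
  for each of its \<open>n\<close> roots.

  \<^emph>\<open>Lower bound for the discriminant.\<close> If \<open>l\<close> is the leading coefficient of \<open>P\<close> and
  \<open>\<beta>\<^sub>1, \<dots>\<close> are the critical points, the discriminant has absolute value
  \<open>n ^ n * \<bar>l\<bar> ^ (n - 1) * \<Prod>\<bar>P(\<beta>\<^sub>k)\<bar>\<close> (\<open>root_gaps_critical_points\<close>). The critical points do not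
  depend on the constant term \<open>y\<close>, and \<open>P(\<beta>\<^sub>k)\<close> is \<open>y\<close> plus a quantity independent of \<open>y\<close>; so all
  factors are at least 1 as soon as \<open>y\<close> avoids at most two integers for each \<open>k\<close>. One more value of
  \<open>y\<close> is avoided to keep the degree equal to \<open>n\<close> after the substitution
  (\<open>card_good_constant_terms\<close>).
\<close>

section \<open>Discriminants, roots and critical points\<close>

text \<open>
  The product runs over ordered pairs, so that it equals the product of
  \<open>(norm (\<alpha> i - \<alpha> j))\<^sup>2\<close> over \<open>i < j\<close> and has no signs to keep track of.
\<close>
definition root_gaps :: "nat \<Rightarrow> (nat \<Rightarrow> complex) \<Rightarrow> real" where
  "root_gaps n \<alpha> = (\<Prod>j<n. \<Prod>i\<in>{..<n} - {j}. norm (\<alpha> i - \<alpha> j))"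

lemma norm_poly_discr:
  assumes "map_poly of_int P = smult (of_int l) (\<Prod>i<n. [:-\<alpha> i, 1:] :: complex poly)" "l \<noteq> 0"
  shows "norm (poly_discr P) = of_int \<bar>l\<bar> ^ (2 * n - 2) * root_gaps n \<alpha>"
proof -
  have "degree (map_poly of_int P :: complex poly) = degree P"
    by (simp add: degree_map_poly)
  moreover have "degree (map_poly of_int P :: complex poly) = n"
    using assms by (simp add: degree_prod_sum_eq)
  ultimately have deg: "degree P = n" by simp
  have "lead_coeff (map_poly of_int P :: complex poly) = of_int l"
    using assms by (simp add: lead_coeff_prod)
  hence lead: "lead_coeff P = l"
    by (simp add: coeff_map_poly degree_map_poly)
  have "proots (map_poly of_int P :: complex poly) = (\<Sum>i<n. {#\<alpha> i#})"
    using assms by (simp add: proots_prod)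
  also have "\<dots> = mset (map \<alpha> [0..<n])"
    by (induction n) auto
  finally have "poly_discr P = of_int l ^ (2 * n - 2) *
      (\<Prod>j<n. \<Prod>i<j. (map \<alpha> [0..<n] ! i - map \<alpha> [0..<n] ! j)\<^sup>2)"
    using poly_discr_eq[of "map \<alpha> [0..<n]" P n] deg lead by simp
  also have "(\<Prod>j<n. \<Prod>i<j. (map \<alpha> [0..<n] ! i - map \<alpha> [0..<n] ! j)\<^sup>2) =
      (\<Prod>j<n. \<Prod>i<j. (\<alpha> i - \<alpha> j)\<^sup>2)"
    by (intro prod.cong) auto
  finally show ?thesis
    unfolding prod_pairs_square_eq root_gaps_def
    by (simp add: norm_mult norm_power prod_norm[symmetric])
qed

lemma complex_poly_split:
  fixes p :: "complex poly"
  assumes "degree p = n"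
  obtains \<alpha> where "p = smult (lead_coeff p) (\<Prod>i<n. [:-\<alpha> i, 1:])"
  using complex_poly_decompose'[of p] assms by metis

lemma poly_pderiv_split:
  fixes \<alpha> :: "nat \<Rightarrow> complex"
  shows "poly (pderiv (smult l (\<Prod>i<n. [:-\<alpha> i, 1:]))) z =
           l * (\<Sum>j<n. \<Prod>i\<in>{..<n} - {j}. z - \<alpha> i)"
  by (simp add: pderiv_smult pderiv_prod poly_sum poly_prod pderiv_pCons)

text \<open>
  In the sum of \<open>poly_pderiv_split\<close> every term but the \<open>j\<close>-th contains the factor
  \<open>\<alpha> j - \<alpha> j\<close>.
\<close>
lemma poly_pderiv_split_root:
  fixes \<alpha> :: "nat \<Rightarrow> complex"
  assumes "j < n"
  shows "poly (pderiv (smult l (\<Prod>i<n. [:-\<alpha> i, 1:]))) (\<alpha> j) =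
           l * (\<Prod>i\<in>{..<n} - {j}. \<alpha> j - \<alpha> i)"
proof -
  have "(\<Sum>k<n. \<Prod>i\<in>{..<n} - {k}. \<alpha> j - \<alpha> i) =
        (\<Sum>k<n. if k = j then \<Prod>i\<in>{..<n} - {j}. \<alpha> j - \<alpha> i else 0)"
    by (rule sum.cong) (use assms in \<open>auto intro!: prod_zero\<close>)
  thus ?thesis using assms by (simp add: poly_pderiv_split)
qed

text \<open>
  Both sides come from the product of \<open>p'(\<alpha> j)\<close> over the roots \<open>\<alpha> j\<close> of \<open>p\<close>, that is, up to
  a power of \<open>l\<close>, from the resultant of \<open>p\<close> and its derivative: expanding \<open>p'\<close> at a root of \<open>p\<close> gives the gaps between the
  roots, and splitting \<open>p'\<close> into linear factors and exchanging the products gives the values of \<open>p\<close>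
  at the critical points.
\<close>
lemma root_gaps_critical_points:
  fixes \<alpha> \<beta> :: "nat \<Rightarrow> complex"
  assumes p: "p = smult l (\<Prod>i<n. [:-\<alpha> i, 1:])" and l: "l \<noteq> 0"
    and p': "pderiv p = smult (of_nat n * l) (\<Prod>k<n - 1. [:-\<beta> k, 1:])"
  shows "norm l ^ (n - 1) * root_gaps n \<alpha> = real n ^ n * (\<Prod>k<n - 1. norm (poly p (\<beta> k)))"
proof -
  have "norm l ^ n * root_gaps n \<alpha> = (\<Prod>j<n. norm (poly (pderiv p) (\<alpha> j)))"
    by (simp add: p poly_pderiv_split_root root_gaps_def norm_mult prod.distrib
        prod_norm[symmetric] norm_minus_commute)
  also have "\<dots> = (\<Prod>j<n. real n * norm l * (\<Prod>k<n - 1. norm (\<alpha> j - \<beta> k)))"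
    unfolding p' by (simp add: poly_prod norm_mult prod_norm[symmetric])
  also have "\<dots> = (real n * norm l) ^ n * (\<Prod>k<n - 1. \<Prod>j<n. norm (\<alpha> j - \<beta> k))"
    unfolding prod.distrib by (subst prod.swap) (simp add: power_mult_distrib)
  finally have "norm l ^ n * (norm l ^ (n - 1) * root_gaps n \<alpha>) =
      norm l ^ n * (real n ^ n * (norm l ^ (n - 1) * (\<Prod>k<n - 1. \<Prod>j<n. norm (\<alpha> j - \<beta> k))))"
    using l by (simp add: power_mult_distrib mult_ac)
  also have "norm l ^ (n - 1) * (\<Prod>k<n - 1. \<Prod>j<n. norm (\<alpha> j - \<beta> k)) =
      (\<Prod>k<n - 1. norm (poly p (\<beta> k)))"
    unfolding p by (simp add: poly_prod norm_mult prod_norm[symmetric] prod.distrib norm_minus_commute)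
  finally show ?thesis using l by simp
qed

text \<open>
  The logarithmic derivative \<open>p' / p\<close> at \<open>z\<close> is the sum of the \<open>1 / (z - \<alpha> i)\<close>. If all roots
  had distance at least \<open>r\<close> from \<open>z\<close>, its absolute value would be at most \<open>n / r\<close>.
\<close>
lemma root_near:
  fixes \<alpha> :: "nat \<Rightarrow> complex"
  assumes p: "p = smult l (\<Prod>i<n. [:-\<alpha> i, 1:])"
    and small: "real n * norm (poly p z) < r * norm (poly (pderiv p) z)" and r: "r > 0"
  shows "\<exists>i<n. norm (z - \<alpha> i) < r"
proof (rule ccontr)
  assume "\<not> (\<exists>i<n. norm (z - \<alpha> i) < r)"
  hence far: "norm (z - \<alpha> i) \<ge> r" if "i < n" for i
    using that by force
  have "r * norm (poly (pderiv p) z) = r * norm (\<Sum>j<n. l * (\<Prod>i\<in>{..<n} - {j}. z - \<alpha> i))"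
    by (simp add: p poly_pderiv_split sum_distrib_left)
  also have "\<dots> \<le> r * (\<Sum>j<n. norm (l * (\<Prod>i\<in>{..<n} - {j}. z - \<alpha> i)))"
    using r by (intro mult_left_mono norm_sum) auto
  also have "\<dots> \<le> (\<Sum>j<n. norm (poly p z))"
    unfolding sum_distrib_left
  proof (intro sum_mono)
    fix j assume j: "j \<in> {..<n}"
    have "r * norm (l * (\<Prod>i\<in>{..<n} - {j}. z - \<alpha> i)) \<le>
        norm (z - \<alpha> j) * norm (l * (\<Prod>i\<in>{..<n} - {j}. z - \<alpha> i))"
      using far j by (intro mult_right_mono) auto
    also have "\<dots> = norm (l * ((z - \<alpha> j) * (\<Prod>i\<in>{..<n} - {j}. z - \<alpha> i)))"
      by (simp only: norm_mult mult.left_commute)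
    also have "(z - \<alpha> j) * (\<Prod>i\<in>{..<n} - {j}. z - \<alpha> i) = (\<Prod>i<n. z - \<alpha> i)"
      using j by (simp only: prod.remove[of "{..<n}" j] finite_lessThan)
    also have "norm (l * (\<Prod>i<n. z - \<alpha> i)) = norm (poly p z)"
      by (simp add: p poly_prod)
    finally show "r * norm (l * (\<Prod>i\<in>{..<n} - {j}. z - \<alpha> i)) \<le> norm (poly p z)" .
  qed
  finally show False using small by simp
qed

text \<open>
  Outside the unit disc, the leading term has to be balanced by \<open>n\<close> terms of degree at most
  \<open>n - 1\<close>, each of them at most \<open>M * norm (lead_coeff p) * norm z ^ (n - 1)\<close>.
\<close>
lemma poly_root_bound:
  fixes p :: "complex poly"
  assumes root: "poly p z = 0" and deg: "degree p = n" "n \<ge> 1"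
    and coeffs: "\<And>k. norm (coeff p k) \<le> M * norm (lead_coeff p)" and M: "M \<ge> 1"
  shows "norm z \<le> real n * M"
proof (cases "norm z \<le> 1")
  case True
  have "1 * 1 \<le> real n * M" using deg M by (intro mult_mono) auto
  thus ?thesis using True by simp
next
  case False
  define L where "L = norm (lead_coeff p)"
  have L: "L > 0" using deg by (auto simp: L_def)
  obtain k where k: "n = Suc k" using deg by (cases n) auto
  have "lead_coeff p * z ^ n = - (\<Sum>i<n. coeff p i * z ^ i)"
  proof -
    have "{..n} = insert n {..<n}" by auto
    thus ?thesis using root by (simp add: poly_altdef deg add_eq_0_iff2)
  qed
  hence "L * norm z ^ n = norm (\<Sum>i<n. coeff p i * z ^ i)"
    by (metis L_def norm_minus_cancel norm_mult norm_power)
  also have "\<dots> \<le> (\<Sum>i<n. M * L * norm z ^ k)"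
  proof (rule order_trans[OF norm_sum], rule sum_mono)
    fix i assume "i \<in> {..<n}"
    hence "norm z ^ i \<le> norm z ^ k" using False k by (intro power_increasing) auto
    thus "norm (coeff p i * z ^ i) \<le> M * L * norm z ^ k"
      unfolding norm_mult norm_power using coeffs[of i] M L by (intro mult_mono) (auto simp: L_def)
  qed
  also have "\<dots> = L * norm z ^ k * (real n * M)" by simp
  finally have "(L * norm z ^ k) * norm z \<le> (L * norm z ^ k) * (real n * M)"
    by (simp add: k mult_ac)
  moreover have "L * norm z ^ k > 0" using L False by (intro mult_pos_pos zero_less_power) auto
  ultimately show ?thesis by (simp only: mult_le_cancel_left_pos)
qed

lemma root_gaps_le:
  assumes "\<And>i. i < n \<Longrightarrow> norm (\<alpha> i) \<le> R"
  shows "root_gaps n \<alpha> \<le> ((2 * R) ^ (n - 1)) ^ n"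
proof -
  have "root_gaps n \<alpha> \<le> (\<Prod>j<n. (2 * R) ^ (n - 1))"
    unfolding root_gaps_def
  proof (intro prod_mono conjI prod_nonneg ballI)
    fix j assume j: "j \<in> {..<n}"
    have "(\<Prod>i\<in>{..<n} - {j}. norm (\<alpha> i - \<alpha> j)) \<le> (\<Prod>i\<in>{..<n} - {j}. 2 * R)"
    proof (intro prod_mono conjI)
      fix i assume "i \<in> {..<n} - {j}"
      thus "norm (\<alpha> i - \<alpha> j) \<le> 2 * R"
        using assms[of i] assms[of j] j norm_triangle_ineq4[of "\<alpha> i" "\<alpha> j"] by auto
    qed auto
    thus "(\<Prod>i\<in>{..<n} - {j}. norm (\<alpha> i - \<alpha> j)) \<le> (2 * R) ^ (n - 1)"
      using j by simp
  qed auto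
  thus ?thesis by simp
qed

section \<open>Unimodular substitutions in binary forms\<close>

text \<open>
  The degree \<open>n\<close> of the form is a parameter, since the definition makes sense for every polynomial
  of degree at most \<open>n\<close>, and the exponent of \<open>y\<close> depends on it.
\<close>
definition binary_form :: "nat \<Rightarrow> 'a::comm_ring_1 poly \<Rightarrow> 'a \<Rightarrow> 'a \<Rightarrow> 'a" where
  "binary_form n p x y = (\<Sum>k\<le>n. coeff p k * x ^ k * y ^ (n - k))"

lemma binary_form_linear_mult:
  assumes "degree p \<le> n"
  shows "binary_form (Suc n) ([:-r, 1:] * p) x y = (x - r * y) * binary_form n p x y"
proof -
  have *: "coeff ([:-r, 1:] * p) k = (if k = 0 then 0 else coeff p (k - 1)) - r * coeff p k" for k
    by (cases k) auto
  have 1: "(\<Sum>k\<le>Suc n. coeff p k * x ^ k * y ^ (Suc n - k)) = y * binary_form n p x y"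
  proof -
    have "(\<Sum>k\<le>Suc n. coeff p k * x ^ k * y ^ (Suc n - k)) =
        (\<Sum>k\<le>n. coeff p k * x ^ k * y ^ (Suc n - k))"
      using assms by (simp add: coeff_eq_0)
    also have "\<dots> = (\<Sum>k\<le>n. y * (coeff p k * x ^ k * y ^ (n - k)))"
      by (intro sum.cong refl) (simp add: Suc_diff_le mult_ac)
    finally show ?thesis by (simp add: binary_form_def sum_distrib_left)
  qed
  have 2: "(\<Sum>k\<le>Suc n. (if k = 0 then 0 else coeff p (k - 1)) * x ^ k * y ^ (Suc n - k)) =
      x * binary_form n p x y"
    by (subst sum.atMost_Suc_shift) (simp add: binary_form_def sum_distrib_left mult_ac)
  have "binary_form (Suc n) ([:-r, 1:] * p) x y =
     (\<Sum>k\<le>Suc n. (if k = 0 then 0 else coeff p (k - 1)) * x ^ k * y ^ (Suc n - k)) -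
     r * (\<Sum>k\<le>Suc n. coeff p k * x ^ k * y ^ (Suc n - k))"
    unfolding binary_form_def * sum_distrib_left sum_subtractf[symmetric]
    by (intro sum.cong refl) (simp add: algebra_simps)
  thus ?thesis unfolding 1 2 by (simp add: algebra_simps)
qed

lemma binary_form_split:
  fixes \<alpha> :: "nat \<Rightarrow> 'a::idom"
  shows "binary_form n (smult l (\<Prod>i<n. [:-\<alpha> i, 1:])) x y = l * (\<Prod>i<n. x - \<alpha> i * y)"
proof (induction n)
  case (Suc n)
  have "smult l (\<Prod>i<Suc n. [:-\<alpha> i, 1:]) = [:-\<alpha> n, 1:] * smult l (\<Prod>i<n. [:-\<alpha> i, 1:])"
    by simp
  moreover have "degree (smult l (\<Prod>i<n. [:-\<alpha> i, 1:])) \<le> n"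
    by (rule order_trans[OF degree_smult_le]) (simp add: degree_prod_sum_eq)
  ultimately show ?case
    by (simp only: binary_form_linear_mult Suc.IH) simp
qed (simp add: binary_form_def)

text \<open>
  The polynomial \<open>(c * x + d) ^ n * p ((a * x + b) / (c * x + d))\<close>, written without
  denominators so that it has integer coefficients whenever \<open>a\<close>, \<open>b\<close>, \<open>c\<close>, \<open>d\<close> and \<open>p\<close> do.
\<close>
definition subst_form :: "nat \<Rightarrow> 'a::comm_ring_1 \<Rightarrow> 'a \<Rightarrow> 'a \<Rightarrow> 'a \<Rightarrow> 'a poly \<Rightarrow> 'a poly" where
  "subst_form n a b c d p = (\<Sum>k\<le>n. smult (coeff p k) ([:b, a:] ^ k * [:d, c:] ^ (n - k)))"

lemma poly_subst_form: "poly (subst_form n a b c d p) x = binary_form n p (a * x + b) (c * x + d)"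
  by (simp add: subst_form_def binary_form_def poly_sum poly_power algebra_simps)

lemma of_int_binary_form:
  "of_int (binary_form n p x y) =
     (binary_form n (map_poly of_int p) (of_int x) (of_int y) :: 'a::comm_ring_1)"
  by (simp add: binary_form_def coeff_map_poly)

lemma map_poly_subst_form:
  "map_poly of_int (subst_form n a b c d p) =
     (subst_form n (of_int a) (of_int b) (of_int c) (of_int d) (map_poly of_int p)
       :: 'a::comm_ring_1 poly)"
proof -
  have add: "map_poly of_int (p + q) = map_poly of_int p + (map_poly of_int q :: 'a poly)" for p q
    by (rule poly_eqI) (simp add: coeff_map_poly)
  have sum: "map_poly of_int (sum f A) = (\<Sum>i\<in>A. map_poly of_int (f i) :: 'a poly)"
    for f and A :: "nat set"
    by (induction A rule: infinite_finite_induct) (auto simp: add)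
  have smult: "map_poly of_int (smult r q) = smult (of_int r) (map_poly of_int q :: 'a poly)" for r q
    by (rule poly_eqI) (simp add: coeff_map_poly)
  have mult: "map_poly of_int (p * q) = map_poly of_int p * (map_poly of_int q :: 'a poly)" for p q
    by (rule poly_eqI) (simp add: coeff_map_poly coeff_mult)
  have power: "map_poly of_int (p ^ k) = (map_poly of_int p :: 'a poly) ^ k" for p k
    by (induction k) (auto simp: mult)
  show ?thesis
    by (simp add: subst_form_def sum smult mult power coeff_map_poly map_poly_pCons)
qed

text \<open>
  The root \<open>\<alpha>\<close> moves to its image under the inverse Moebius transformation, and the leading
  coefficient becomes the value of the form at \<open>(a, c)\<close>. The hypothesis says that no root is sent to
  infinity, that is, that the degree does not drop.
\<close>
lemma subst_form_split:
  fixes \<alpha> :: "nat \<Rightarrow> complex"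
  assumes nz: "\<And>i. i < n \<Longrightarrow> a - \<alpha> i * c \<noteq> 0" and p_def: "p = smult l (\<Prod>i<n. [:-\<alpha> i, 1:])"
  shows "subst_form n a b c d p =
           smult (binary_form n p a c) (\<Prod>i<n. [:- ((\<alpha> i * d - b) / (a - \<alpha> i * c)), 1:])"
proof -
  have cancel: "A * (x - q / A) = A * x - q" if "A \<noteq> 0" for A x q :: complex
    using that by (simp add: right_diff_distrib)
  have "poly (subst_form n a b c d p) x =
      poly (smult (binary_form n p a c) (\<Prod>i<n. [:- ((\<alpha> i * d - b) / (a - \<alpha> i * c)), 1:])) x" for x
  proof -
    have "poly (subst_form n a b c d p) x = l * (\<Prod>i<n. (a * x + b) - \<alpha> i * (c * x + d))"
      by (simp add: poly_subst_form p_def binary_form_split)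
    also have "(\<Prod>i<n. (a * x + b) - \<alpha> i * (c * x + d)) =
        (\<Prod>i<n. (a - \<alpha> i * c) * (x - (\<alpha> i * d - b) / (a - \<alpha> i * c)))"
    proof (intro prod.cong refl)
      fix i assume "i \<in> {..<n}"
      hence "a - \<alpha> i * c \<noteq> 0" using nz by simp
      hence "(a - \<alpha> i * c) * (x - (\<alpha> i * d - b) / (a - \<alpha> i * c)) =
          (a - \<alpha> i * c) * x - (\<alpha> i * d - b)"
        using cancel by simp
      thus "(a * x + b) - \<alpha> i * (c * x + d) =
          (a - \<alpha> i * c) * (x - (\<alpha> i * d - b) / (a - \<alpha> i * c))"
        by (simp add: algebra_simps)
    qed
    finally show ?thesis
      by (simp add: p_def binary_form_split prod.distrib poly_prod)
  qed
  thus ?thesis using poly_eq_poly_eq_iff by blast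
qed

text \<open>
  A Moebius transformation of determinant 1 divides \<open>\<alpha> i - \<alpha> j\<close> by
  \<open>(a - \<alpha> i * c) * (a - \<alpha> j * c)\<close>. Each factor \<open>a - \<alpha> i * c\<close> occurs in \<open>2 * n - 2\<close> ordered pairs,
  which is the power in which the leading coefficient enters the discriminant; the two effects cancel.
\<close>
lemma root_gaps_moebius:
  fixes \<alpha> :: "nat \<Rightarrow> complex"
  assumes nz: "\<And>i. i < n \<Longrightarrow> a - \<alpha> i * c \<noteq> 0" and det: "a * d - b * c = 1" and n: "n \<ge> 1"
  shows "(\<Prod>i<n. norm (a - \<alpha> i * c)) ^ (2 * n - 2) *
           root_gaps n (\<lambda>i. (\<alpha> i * d - b) / (a - \<alpha> i * c)) = root_gaps n \<alpha>"
proof -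
  define u where "u i = norm (a - \<alpha> i * c)" for i
  define U where "U = (\<Prod>i<n. u i)"
  have u: "u i \<noteq> 0" if "i < n" for i using nz that by (simp add: u_def)
  hence U: "U \<noteq> 0" by (simp add: U_def)
  have diff: "norm (\<alpha> i - \<alpha> j) =
      norm ((\<alpha> i * d - b) / (a - \<alpha> i * c) - (\<alpha> j * d - b) / (a - \<alpha> j * c)) * (u i * u j)"
    if "i < n" "j < n" for i j
  proof -
    have "(\<alpha> i * d - b) / (a - \<alpha> i * c) - (\<alpha> j * d - b) / (a - \<alpha> j * c) =
        (\<alpha> i - \<alpha> j) * (a * d - b * c) / ((a - \<alpha> i * c) * (a - \<alpha> j * c))"
      using nz that by (simp add: diff_frac_eq algebra_simps)
    thus ?thesis using nz that by (simp add: det norm_divide norm_mult u_def)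
  qed
  have "(\<Prod>j<n. \<Prod>i\<in>{..<n} - {j}. u i * u j) = (\<Prod>j<n. U * u j ^ (n - 1) / u j)"
    by (intro prod.cong refl) (use u in \<open>auto simp: prod.distrib U_def prod_diff1\<close>)
  also have "\<dots> = U ^ n * U ^ (n - 1) / U"
    by (simp add: prod.distrib prod_dividef prod_power_distrib[symmetric] flip: U_def)
  also have "\<dots> = U ^ (2 * n - 2)"
  proof -
    obtain k where "n = Suc k" using n by (cases n) auto
    thus ?thesis using U by (simp add: mult_2 power_add)
  qed
  finally have prod: "(\<Prod>j<n. \<Prod>i\<in>{..<n} - {j}. u i * u j) = U ^ (2 * n - 2)" .
  have "root_gaps n \<alpha> = (\<Prod>j<n. \<Prod>i\<in>{..<n} - {j}.
      norm ((\<alpha> i * d - b) / (a - \<alpha> i * c) - (\<alpha> j * d - b) / (a - \<alpha> j * c)) * (u i * u j))"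
    unfolding root_gaps_def by (intro prod.cong refl diff) auto
  also have "\<dots> = root_gaps n (\<lambda>i. (\<alpha> i * d - b) / (a - \<alpha> i * c)) * U ^ (2 * n - 2)"
    by (subst prod[symmetric]) (simp add: prod.distrib root_gaps_def)
  finally show ?thesis by (simp add: U_def u_def mult.commute)
qed

lemma subst_form_int:
  fixes P :: "int poly" and \<alpha> :: "nat \<Rightarrow> complex"
  assumes P: "map_poly of_int P = smult (of_int l) (\<Prod>i<n. [:-\<alpha> i, 1:])" and l: "l \<noteq> 0"
    and n: "n \<ge> 1" and det: "a * d - b * c = 1" and lead: "binary_form n P a c \<noteq> 0"
  defines "G \<equiv> subst_form n a b c d P"
  shows "degree G = n"
    and "map_poly of_int G = smult (of_int (binary_form n P a c))
           (\<Prod>i<n. [:- ((\<alpha> i * of_int d - of_int b) / (of_int a - \<alpha> i * of_int c)), 1:])"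
    and "norm (poly_discr G) = norm (poly_discr P)"
proof -
  have ln: "of_int (binary_form n P a c) = of_int l * (\<Prod>i<n. of_int a - \<alpha> i * of_int c)"
    by (simp add: of_int_binary_form P binary_form_split)
  hence nz: "of_int a - \<alpha> i * of_int c \<noteq> 0" if "i < n" for i
    using lead that by (metis (mono_tags, lifting) finite_lessThan lessThan_iff mult_zero_right
        of_int_eq_0_iff prod_zero_iff)
  show G: "map_poly of_int G = smult (of_int (binary_form n P a c))
           (\<Prod>i<n. [:- ((\<alpha> i * of_int d - of_int b) / (of_int a - \<alpha> i * of_int c)), 1:])"
    unfolding G_def map_poly_subst_form of_int_binary_form P
    by (rule subst_form_split) (use nz in auto)
  have "degree (map_poly of_int G :: complex poly) = n"
    unfolding G using lead by (simp add: degree_prod_sum_eq)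
  thus "degree G = n" by (simp add: degree_map_poly)
  have det': "of_int a * of_int d - of_int b * of_int c = (1 :: complex)"
    using arg_cong[OF det, of "of_int :: int \<Rightarrow> complex"] by simp
  have "norm (of_int (binary_form n P a c) :: complex) =
      of_int \<bar>l\<bar> * (\<Prod>i<n. norm (of_int a - \<alpha> i * of_int c))"
    unfolding ln by (simp add: norm_mult prod_norm[symmetric])
  hence absln: "of_int \<bar>binary_form n P a c\<bar> =
      of_int \<bar>l\<bar> * (\<Prod>i<n. norm (of_int a - \<alpha> i * of_int c))"
    by simp
  show "norm (poly_discr G) = norm (poly_discr P)"
    unfolding norm_poly_discr[OF P l] norm_poly_discr[OF G lead] absln
    using root_gaps_moebius[OF nz det' n] by (simp add: power_mult_distrib mult.assoc)
qed

text \<open>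
  Up to a nonzero factor, the values of the substituted polynomial are the values of \<open>p\<close> at all
  points except \<open>a / c\<close>, and these determine \<open>p\<close>.
\<close>
lemma subst_form_inj:
  fixes p q :: "'a::field_char_0 poly"
  assumes eq: "subst_form n a b c d p = subst_form n a b c d q" and det: "a * d - b * c = 1"
    and "degree p \<le> n" "degree q \<le> n"
  shows "p = q"
proof -
  have form: "binary_form n r x 1 = poly r x" if "degree r \<le> n" for r :: "'a poly" and x
  proof -
    have "(\<Sum>k\<le>n. coeff r k * x ^ k) = (\<Sum>k\<le>degree r. coeff r k * x ^ k)"
      using that by (intro sum.mono_neutral_right) (auto simp: coeff_eq_0)
    thus ?thesis by (simp add: binary_form_def poly_altdef)
  qed
  have hom: "binary_form n r (t * x) (t * y) = t ^ n * binary_form n r x y" for r :: "'a poly" and t x y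
    unfolding binary_form_def sum_distrib_left
  proof (intro sum.cong refl)
    fix k assume "k \<in> {..n}"
    hence "t ^ n = t ^ k * t ^ (n - k)" by (simp flip: power_add)
    thus "coeff r k * (t * x) ^ k * (t * y) ^ (n - k) = t ^ n * (coeff r k * x ^ k * y ^ (n - k))"
      by (simp add: power_mult_distrib mult_ac)
  qed
  (* The substitution is invertible away from one point: y is the image of x under the Moebius
     transformation, and the denominator c * x + d is 1 / (a - c * y) because the determinant is 1. *)
  have "poly p y = poly q y" if y: "a - c * y \<noteq> 0" for y
  proof -
    define x where "x = (d * y - b) / (a - c * y)"
    have 1: "a * x + b = 1 / (a - c * y) * y"
    proof -
      have "a * x + b = (a * (d * y - b) + b * (a - c * y)) / (a - c * y)"
        using y by (simp add: x_def add_divide_distrib)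
      also have "a * (d * y - b) + b * (a - c * y) = (a * d - b * c) * y"
        by (simp add: algebra_simps)
      finally show ?thesis by (simp add: det)
    qed
    have 2: "c * x + d = 1 / (a - c * y) * 1"
    proof -
      have "c * x + d = (c * (d * y - b) + d * (a - c * y)) / (a - c * y)"
        using y by (simp add: x_def add_divide_distrib)
      also have "c * (d * y - b) + d * (a - c * y) = a * d - b * c"
        by (simp add: algebra_simps)
      finally show ?thesis by (simp add: det)
    qed
    have "poly (subst_form n a b c d r) x = (1 / (a - c * y)) ^ n * poly r y"
      if "degree r \<le> n" for r
      unfolding poly_subst_form 1 2 hom using form[OF that] by simp
    from this[OF assms(3)] this[OF assms(4)] show ?thesis using y by (simp add: eq)
  qed
  hence "UNIV - {y. a - c * y = 0} \<subseteq> {y. poly (p - q) y = 0}" by auto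
  moreover have "finite {y. a - c * y = 0}"
  proof -
    have "[:a, - c:] \<noteq> 0" using det by auto
    hence "finite {y. poly [:a, -c:] y = 0}" by (rule poly_roots_finite)
    thus ?thesis by (simp add: mult.commute)
  qed
  ultimately have "infinite {y. poly (p - q) y = 0}"
    using infinite_UNIV_char_0[where 'a='a] by (meson Diff_infinite_finite infinite_super)
  thus ?thesis using poly_roots_finite[of "p - q"] by auto
qed

lemma subst_form_inj_int:
  fixes p q :: "int poly"
  assumes eq: "subst_form n a b c d p = subst_form n a b c d q" and det: "a * d - b * c = 1"
    and "degree p \<le> n" "degree q \<le> n"
  shows "p = q"
proof -
  have "map_poly of_int p = (map_poly of_int q :: complex poly)"
  proof (rule subst_form_inj)
    show "subst_form n (of_int a) (of_int b) (of_int c) (of_int d) (map_poly of_int p) =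
        (subst_form n (of_int a) (of_int b) (of_int c) (of_int d) (map_poly of_int q) :: complex poly)"
      by (simp flip: map_poly_subst_form add: eq)
    show "of_int a * of_int d - of_int b * of_int c = (1 :: complex)"
      using arg_cong[OF det, of "of_int :: int \<Rightarrow> complex"] by simp
  qed (use assms in \<open>auto simp: degree_map_poly\<close>)
  thus ?thesis
    by (simp add: poly_eq_iff coeff_map_poly)
qed

lemma abs_coeff_linear_product_le:
  fixes p :: "int poly"
  assumes "\<And>i. \<bar>coeff p i\<bar> \<le> M" "\<bar>u\<bar> \<le> N" "\<bar>v\<bar> \<le> N"
  shows "\<bar>coeff ([:u, v:] * p) i\<bar> \<le> 2 * N * M"
proof -
  have M: "M \<ge> 0" using assms(1)[of 0] by linarith
  have "\<bar>x * coeff p j\<bar> \<le> N * M" if "\<bar>x\<bar> \<le> N" for x j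
    unfolding abs_mult using assms(1)[of j] that M by (intro mult_mono) auto
  hence bounds: "\<bar>u * coeff p i\<bar> \<le> N * M" "\<bar>v * coeff p (i - 1)\<bar> \<le> N * M"
    using assms(2,3) by blast+
  have expand: "coeff ([:u, v:] * p) i = u * coeff p i + (if i = 0 then 0 else v * coeff p (i - 1))"
    by (cases i) auto
  have "N * M \<ge> 0" using M assms(2) by (intro mult_nonneg_nonneg) auto
  hence "\<bar>if i = 0 then 0 else v * coeff p (i - 1)\<bar> \<le> N * M"
    using bounds(2) by simp
  hence "\<bar>coeff ([:u, v:] * p) i\<bar> \<le> N * M + N * M"
    unfolding expand by (rule order_trans[OF abs_triangle_ineq add_mono[OF bounds(1)]])
  thus ?thesis by (simp only: mult_2 distrib_right)
qed

text \<open>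
  Each of the \<open>n + 1\<close> terms is a product of \<open>n\<close> linear factors with coefficients at most \<open>N\<close>, and
  each such factor multiplies the coefficient bound by \<open>2 * N\<close>.
\<close>
lemma abs_coeff_subst_form_le:
  fixes P :: "int poly"
  assumes P: "\<And>k. \<bar>coeff P k\<bar> \<le> M"
    and N: "\<bar>a\<bar> \<le> N" "\<bar>b\<bar> \<le> N" "\<bar>c\<bar> \<le> N" "\<bar>d\<bar> \<le> N"
  shows "\<bar>coeff (subst_form n a b c d P) i\<bar> \<le> (int n + 1) * M * (2 * N) ^ n"
proof -
  have power: "\<bar>coeff ([:u, v:] ^ k * p) i\<bar> \<le> (2 * N) ^ k * M'"
    if "\<And>i. \<bar>coeff p i\<bar> \<le> M'" "\<bar>u\<bar> \<le> N" "\<bar>v\<bar> \<le> N" for u v k i M' and p :: "int poly"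
  proof (induction k arbitrary: i)
    case (Suc k)
    show ?case
      using abs_coeff_linear_product_le[OF Suc.IH that(2,3), of i] by (simp only: power_Suc mult.assoc)
  qed (use that in auto)
  have one: "\<bar>coeff (1 :: int poly) i\<bar> \<le> 1" for i by (simp add: coeff_1)
  have M: "M \<ge> 0" using P[of 0] by linarith
  have "\<bar>coeff (subst_form n a b c d P) i\<bar> \<le>
      (\<Sum>k\<le>n. \<bar>coeff P k * coeff ([:b, a:] ^ k * [:d, c:] ^ (n - k)) i\<bar>)"
    by (simp add: subst_form_def coeff_sum sum_abs)
  also have "\<dots> \<le> (\<Sum>k\<le>n. M * (2 * N) ^ n)"
  proof (intro sum_mono)
    fix k assume k: "k \<in> {..n}"
    have "\<bar>coeff ([:d, c:] ^ (n - k) * 1) j\<bar> \<le> (2 * N) ^ (n - k) * 1" for j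
      by (rule power[OF one N(4,3)])
    hence "\<bar>coeff ([:b, a:] ^ k * [:d, c:] ^ (n - k)) i\<bar> \<le> (2 * N) ^ k * (2 * N) ^ (n - k)"
      by (intro power N) simp
    also have "\<dots> = (2 * N) ^ n" using k by (simp only: power_add[symmetric]) simp
    finally show "\<bar>coeff P k * coeff ([:b, a:] ^ k * [:d, c:] ^ (n - k)) i\<bar> \<le> M * (2 * N) ^ n"
      unfolding abs_mult using P[of k] M by (intro mult_mono) auto
  qed
  finally show ?thesis by (simp add: algebra_simps)
qed

section \<open>Roots high in the upper half-plane\<close>

text \<open>
  With \<open>u = a - \<alpha> * c\<close> one has \<open>c * w + d = 1 / u\<close> and \<open>Im w = Im \<alpha> / (norm u)\<^sup>2\<close>, both because
  the determinant is 1. So the claim is \<open>1 < Im \<alpha>\<close>.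
\<close>
lemma moebius_high_root:
  fixes \<alpha> :: complex and a b :: int and c d :: nat
  assumes \<alpha>: "Im \<alpha> > 1" and det: "a * int d - b * int c = 1" and c: "c \<ge> 1"
  defines "w \<equiv> (\<alpha> * of_int (int d) - of_int b) / (of_int a - \<alpha> * of_int (int c))"
  shows "norm (of_nat c * w + of_nat d) ^ 2 < Im w"
proof -
  define u where "u = of_int a - \<alpha> * of_nat c"
  have det_real: "real_of_int a * real d - real_of_int b * real c = 1"
    using arg_cong[OF det, of real_of_int] by simp
  have det_complex: "of_int a * of_nat d - of_int b * of_nat c = (1 :: complex)"
    using arg_cong[OF det, of "of_int :: int \<Rightarrow> complex"] by simp
  have "Im u \<noteq> 0" using \<alpha> c by (simp add: u_def)
  hence u: "u \<noteq> 0" by auto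
  have w: "w = (\<alpha> * of_nat d - of_int b) / u" by (simp add: w_def u_def)
  have "of_nat c * w + of_nat d = (of_nat c * (\<alpha> * of_nat d - of_int b) + of_nat d * u) / u"
    using u by (simp add: w add_divide_distrib)
  also have "of_nat c * (\<alpha> * of_nat d - of_int b) + of_nat d * u = 1"
    using det_complex by (simp add: u_def algebra_simps)
  finally have "norm (of_nat c * w + of_nat d) ^ 2 = 1 / norm u ^ 2"
    by (simp add: norm_divide power_divide)
  moreover have "Im w = Im \<alpha> / norm u ^ 2"
  proof -
    have "w = ((\<alpha> * of_nat d - of_int b) * cnj u) / of_real (norm u ^ 2)"
      unfolding w by (subst complex_div_cnj) simp
    hence "Im w = Im ((\<alpha> * of_nat d - of_int b) * cnj u) / norm u ^ 2"
      by (simp only: Im_divide_of_real)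
    also have "Im ((\<alpha> * of_nat d - of_int b) * cnj u) =
        Im \<alpha> * (real_of_int a * real d - real_of_int b * real c)"
      by (simp add: u_def algebra_simps)
    finally show ?thesis by (simp add: det_real)
  qed
  ultimately show ?thesis using \<alpha> u by (simp add: divide_strict_right_mono)
qed

text \<open>
  The imaginary part of \<open>(c1 * w + d1) * cnj (c2 * w + d2)\<close> is \<open>Im w * (c1 * d2 - c2 * d1)\<close>, while
  its absolute value is less than \<open>Im w\<close>. Hence the integer \<open>c1 * d2 - c2 * d1\<close> is 0, and the two
  fractions are equal and in lowest terms.
\<close>
lemma high_orbit_point_unique:
  fixes c1 d1 c2 d2 :: nat and w :: complex
  assumes "norm (of_nat c1 * w + of_nat d1) ^ 2 < Im w" "norm (of_nat c2 * w + of_nat d2) ^ 2 < Im w"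
    and cop: "coprime c1 d1" "coprime c2 d2" 
  shows "c1 = c2 \<and> d1 = d2"
proof -
  define x where "x = of_nat c1 * w + of_nat d1"
  define y where "y = of_nat c2 * w + of_nat d2"
  have pos: "Im w > 0" using assms(1) zero_le_power2[of "norm (of_nat c1 * w + of_nat d1)"] by linarith
  have "Im (x * cnj y) = Im w * (real c1 * real d2 - real c2 * real d1)"
    by (simp add: x_def y_def algebra_simps)
  hence "Im w * \<bar>real c1 * real d2 - real c2 * real d1\<bar> = \<bar>Im (x * cnj y)\<bar>"
    using pos by (simp add: abs_mult)
  also have "\<dots> \<le> norm x * norm y" using abs_Im_le_cmod[of "x * cnj y"] by (simp add: norm_mult)
  also have "\<dots> < Im w"
  proof -
    have "2 * (norm x * norm y) \<le> norm x ^ 2 + norm y ^ 2"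
      using zero_le_power2[of "norm x - norm y"] by (simp add: power2_eq_square algebra_simps)
    thus ?thesis using assms(1,2) by (simp add: x_def y_def)
  qed
  finally have "\<bar>real c1 * real d2 - real c2 * real d1\<bar> < 1"
    using pos by (simp add: mult_less_cancel_left2)
  moreover have "real c1 * real d2 - real c2 * real d1 = of_int (int c1 * int d2 - int c2 * int d1)"
    by simp
  ultimately have "int c1 * int d2 - int c2 * int d1 = 0" by linarith
  hence "int (c1 * d2) = int (c2 * d1)" by simp
  hence eq: "c1 * d2 = c2 * d1" by (simp only: of_nat_eq_iff)
  have dvd: "c1 dvd c2 * d1" "c2 dvd c1 * d2" "d1 dvd c1 * d2" "d2 dvd c2 * d1"
    using eq by (metis dvd_triv_left dvd_triv_right)+
  have "c1 dvd c2" using dvd(1) cop(1) by (simp add: coprime_dvd_mult_left_iff)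
  moreover have "c2 dvd c1" using dvd(2) cop(2) by (simp add: coprime_dvd_mult_left_iff)
  moreover have "d1 dvd d2"
    using dvd(3) cop(1) by (simp add: coprime_dvd_mult_right_iff coprime_commute)
  moreover have "d2 dvd d1"
    using dvd(4) cop(2) by (simp add: coprime_dvd_mult_right_iff coprime_commute)
  ultimately show ?thesis by (auto intro: dvd_antisym)
qed

section \<open>Coprime pairs\<close>

lemma sum_inverse_squares_le:
  assumes "N \<ge> 2"
  shows "(\<Sum>k=2..N. 1 / (real k)\<^sup>2) \<le> 3 / 4 - 1 / real N"
  using assms
proof (induction N rule: nat_induct_at_least)
  case (Suc N)
  have "1 / (real (Suc N))\<^sup>2 \<le> 1 / (real N * real (Suc N))"
    using Suc by (intro divide_left_mono) (auto simp: power2_eq_square)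
  also have "\<dots> = 1 / real N - 1 / real (Suc N)"
    using Suc by (simp add: field_simps)
  finally show ?case using Suc by simp
qed simp

definition coprime_pairs :: "nat \<Rightarrow> (nat \<times> nat) set" where
  "coprime_pairs N = {(c, d) \<in> {1..N} \<times> {1..N}. coprime c d}"

lemma finite_coprime_pairs: "finite (coprime_pairs N)"
  unfolding coprime_pairs_def by (rule finite_subset[of _ "{1..N} \<times> {1..N}"]) auto

text \<open>
  A pair that is not coprime lies in the square of the multiples of some \<open>k \<ge> 2\<close>, which contains at
  most \<open>(N / k)\<^sup>2\<close> pairs; the sum of \<open>1 / k\<^sup>2\<close> over \<open>k \<ge> 2\<close> is at most \<open>3 / 4\<close>.
\<close>
lemma card_coprime_pairs: "real (card (coprime_pairs N)) \<ge> (real N)\<^sup>2 / 4"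
proof (cases "N \<ge> 2")
  case False
  have one: "coprime_pairs 1 = {(1, 1)}" by (auto simp: coprime_pairs_def)
  from False consider "N = 0" | "N = 1" by linarith
  thus ?thesis by cases (simp, simp only: one, simp)
next
  case True
  define M where "M k = {x \<in> {1..N}. k dvd x}" for k
  have fin: "finite (M k)" for k by (simp add: M_def)
  have card_M: "real (card (M k)) \<le> real N / real k" if "k > 0" for k
  proof -
    have "M k \<subseteq> (\<lambda>j. k * j) ` {1..N div k}"
    proof
      fix x assume x: "x \<in> M k"
      then obtain j where j: "x = k * j" by (auto simp: M_def)
      have "j = x div k" using j that by simp
      also have "\<dots> \<le> N div k" using x by (intro div_le_mono) (auto simp: M_def)
      finally have "j \<in> {1..N div k}" using x j by (cases j) (auto simp: M_def)
      thus "x \<in> (\<lambda>j. k * j) ` {1..N div k}" using j by blast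
    qed
    hence "card (M k) \<le> card ((\<lambda>j. k * j) ` {1..N div k})" by (intro card_mono) auto
    also have "\<dots> \<le> N div k" using card_image_le[of "{1..N div k}" "\<lambda>j. k * j"] by simp
    finally have "real (card (M k)) \<le> real (N div k)" by simp
    also have "\<dots> \<le> real N / real k" by (rule of_nat_div_le_of_nat)
    finally show ?thesis .
  qed
  have "{1..N} \<times> {1..N} \<subseteq> coprime_pairs N \<union> (\<Union>k\<in>{2..N}. M k \<times> M k)"
  proof
    fix x assume x: "x \<in> {1..N} \<times> {1..N}"
    obtain c d where cd: "x = (c, d)" by force
    have c: "1 \<le> c" "c \<le> N" "1 \<le> d" "d \<le> N" using x cd by auto
    show "x \<in> coprime_pairs N \<union> (\<Union>k\<in>{2..N}. M k \<times> M k)"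
    proof (cases "coprime c d")
      case True
      thus ?thesis using c cd by (auto simp: coprime_pairs_def)
    next
      case False
      have two: "g \<ge> 2" if "g \<noteq> 1" "g \<noteq> 0" for g :: nat using that by simp
      have "gcd c d \<ge> 2"
        by (rule two) (use False c in \<open>auto simp: coprime_iff_gcd_eq_1\<close>)
      moreover have "gcd c d \<le> N" using c gcd_le1_nat[of c d] by linarith
      ultimately have "gcd c d \<in> {2..N}" by auto
      thus ?thesis using c cd by (auto simp: M_def intro!: bexI[of _ "gcd c d"])
    qed
  qed
  hence "card ({1..N} \<times> {1..N}) \<le> card (coprime_pairs N \<union> (\<Union>k\<in>{2..N}. M k \<times> M k))"
    by (intro card_mono) (auto simp: fin finite_coprime_pairs)
  also have "\<dots> \<le> card (coprime_pairs N) + card (\<Union>k\<in>{2..N}. M k \<times> M k)"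
    by (rule card_Un_le)
  also have "\<dots> \<le> card (coprime_pairs N) + (\<Sum>k=2..N. card (M k \<times> M k))"
    by (intro add_left_mono card_UN_le) auto
  finally have "real (N * N) \<le> real (card (coprime_pairs N) + (\<Sum>k=2..N. card (M k \<times> M k)))"
    by (simp only: of_nat_le_iff card_cartesian_product card_atLeastAtMost) simp
  hence "(real N)\<^sup>2 \<le> real (card (coprime_pairs N)) + (\<Sum>k=2..N. (real (card (M k)))\<^sup>2)"
    by (simp add: power2_eq_square card_cartesian_product)
  also have "(\<Sum>k=2..N. (real (card (M k)))\<^sup>2) \<le> (\<Sum>k=2..N. (real N)\<^sup>2 * (1 / (real k)\<^sup>2))"
  proof (intro sum_mono)
    fix k assume "k \<in> {2..N}"
    hence "(real (card (M k)))\<^sup>2 \<le> (real N / real k)\<^sup>2" by (intro power_mono card_M) auto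
    thus "(real (card (M k)))\<^sup>2 \<le> (real N)\<^sup>2 * (1 / (real k)\<^sup>2)" by (simp add: power_divide)
  qed
  also have "\<dots> = (real N)\<^sup>2 * (\<Sum>k=2..N. 1 / (real k)\<^sup>2)" by (rule sum_distrib_left[symmetric])
  also have "\<dots> \<le> (real N)\<^sup>2 * (3 / 4)"
    by (intro mult_left_mono order_trans[OF sum_inverse_squares_le[OF True]]) auto
  finally show ?thesis by linarith
qed

text \<open>
  Every coprime pair of positive integers is the bottom row of a unimodular matrix whose top row is not larger: reduce
  the first entry of any solution modulo \<open>c\<close>; the determinant then bounds the other one.
\<close>
lemma bounded_bezout:
  assumes "coprime c d" "c \<ge> 1" "d \<ge> 1"
  shows "\<exists>a b :: int. a * int d - b * int c = 1 \<and> \<bar>a\<bar> \<le> int c \<and> \<bar>b\<bar> \<le> int d"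
proof -
  have "coprime (int c) (int d)" using assms by simp
  then obtain u v where uv: "u * int c + v * int d = 1"
    using bezout_int[of "int c" "int d"] by (auto simp: coprime_iff_gcd_eq_1)
  define a where "a = v mod int c"
  define b where "b = - u - int d * (v div int c)"
  have "v = int c * (v div int c) + a" by (simp add: a_def)
  hence "(a + int c * (v div int c)) * int d + u * int c = 1" using uv by (simp add: add.commute)
  hence det: "a * int d - b * int c = 1" by (simp add: b_def algebra_simps)
  have a: "0 \<le> a" "a < int c" using assms by (auto simp: a_def)
  have bc: "b * int c = a * int d - 1" using det by simp
  (* If a = 0 the determinant forces c = 1 and b = - 1, the only case of a negative b. *)
  have "\<bar>b\<bar> \<le> int d"
  proof (cases "a = 0")
    case True
    hence "\<bar>b * int c\<bar> = 1" using bc by simp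
    hence "\<bar>b\<bar> = 1" by (simp add: abs_mult zmult_eq_1_iff)
    thus ?thesis using assms by simp
  next
    case False
    hence "1 * 1 \<le> a * int d" using a assms by (intro mult_mono) auto
    hence "0 \<le> b * int c" using bc by simp
    hence b0: "b \<ge> 0" using assms by (simp add: zero_le_mult_iff)
    have "a * int d \<le> int c * int d" using a by (intro mult_right_mono) auto
    hence "b * int c < int d * int c" using bc by (simp add: mult.commute)
    hence "b < int d" by (simp add: mult_less_cancel_right)
    thus ?thesis using b0 by simp
  qed
  thus ?thesis using det a by (intro exI[of _ a] exI[of _ b]) auto
qed

section \<open>Perturbations of a quadratic polynomial\<close>

text \<open>
  The factor in front of \<open>x\<^sup>2 + 4\<close> is a multiple of \<open>m\<close> large enough for a root near \<open>2 * \<i>\<close>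
  to survive a perturbation with coefficients of size \<open>2 * m\<close>.
\<close>
definition near_quadratic :: "nat \<Rightarrow> nat \<Rightarrow> int list \<Rightarrow> int poly" where
  "near_quadratic n m ys = (let B = int (n * 2 ^ (n + 2) * m) in [:4 * B, 0, B:] + Poly ys)"

text \<open>
  The entries start above \<open>m\<close> and not at 0, so that the leading coefficient is comparable to the
  height and all roots are bounded independently of \<open>m\<close>.
\<close>
definition digit_lists :: "nat \<Rightarrow> nat \<Rightarrow> int list set" where
  "digit_lists m k = {ys. set ys \<subseteq> {int m + 1..2 * int m} \<and> length ys = k}"

definition height_factor :: "nat \<Rightarrow> nat" where
  "height_factor n = n * 2 ^ (n + 4) + 2"

lemma card_digit_lists: "card (digit_lists m k) = m ^ k"
  unfolding digit_lists_def by (subst card_lists_length_eq) auto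

lemma finite_digit_lists: "finite (digit_lists m k)"
  unfolding digit_lists_def by (rule finite_lists_length_eq) simp

lemma coeff_near_quadratic:
  "coeff (near_quadratic n m ys) k =
     (if k = 0 then 4 * int (n * 2 ^ (n + 2) * m) else if k = 2 then int (n * 2 ^ (n + 2) * m) else 0) +
     (if k < length ys then ys ! k else 0)"
proof -
  have "coeff [:4 * B, 0, B:] k = (if k = 0 then 4 * B else if k = 2 then B else 0)" for B :: int
    by (auto simp: coeff_pCons split: nat.splits)
  thus ?thesis unfolding near_quadratic_def Let_def coeff_add by (simp only: coeff_Poly_eq nth_default_def)
qed

lemma near_quadratic_inj:
  assumes "near_quadratic n m xs = near_quadratic n m ys" "length xs = length ys"
  shows "xs = ys"
proof (rule nth_equalityI)
  fix i assume "i < length xs"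
  thus "xs ! i = ys ! i"
    using assms coeff_near_quadratic[of n m xs i] coeff_near_quadratic[of n m ys i] by simp
qed fact

context
  fixes n m :: nat and ys :: "int list"
  assumes n: "n \<ge> 2" and m: "m \<ge> 1" and ys: "ys \<in> digit_lists m (Suc n)"
begin

lemma digit_nth: "k \<le> n \<Longrightarrow> int m + 1 \<le> ys ! k \<and> ys ! k \<le> 2 * int m"
proof -
  assume "k \<le> n"
  hence "ys ! k \<in> set ys" using ys by (intro nth_mem) (simp add: digit_lists_def)
  thus ?thesis using ys by (auto simp: digit_lists_def)
qed

lemma length_digits: "length ys = Suc n"
  using ys by (simp add: digit_lists_def)

lemma lead_near_quadratic_ge: "coeff (near_quadratic n m ys) n \<ge> int m + 1"
proof -
  have "0 \<le> int (n * 2 ^ (n + 2) * m)" by simp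
  thus ?thesis
    unfolding coeff_near_quadratic length_digits using digit_nth[of n] n by (simp only: split: if_split) auto
qed

lemma degree_near_quadratic: "degree (near_quadratic n m ys) = n"
proof (rule antisym)
  show "degree (near_quadratic n m ys) \<le> n"
    by (rule degree_le) (use n in \<open>auto simp: coeff_near_quadratic length_digits\<close>)
  show "n \<le> degree (near_quadratic n m ys)"
    by (rule le_degree) (use lead_near_quadratic_ge in auto)
qed

lemma abs_coeff_near_quadratic_le:
  "\<bar>coeff (near_quadratic n m ys) k\<bar> \<le> int (height_factor n * m)"
proof -
  define B where "B = int (n * 2 ^ (n + 2) * m)"
  have "B \<ge> 0" by (simp add: B_def)
  moreover have "int (height_factor n * m) = 4 * B + 2 * int m"
    by (simp add: height_factor_def B_def power_add algebra_simps)
  ultimately show ?thesis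
    using digit_nth[of k] unfolding coeff_near_quadratic length_digits B_def[symmetric]
    by (auto simp: abs_le_iff)
qed

lemma near_quadratic_split:
  obtains \<alpha> :: "nat \<Rightarrow> complex" where
    "map_poly of_int (near_quadratic n m ys) =
       smult (of_int (coeff (near_quadratic n m ys) n)) (\<Prod>i<n. [:-\<alpha> i, 1:])"
proof -
  have deg: "degree (map_poly of_int (near_quadratic n m ys) :: complex poly) = n"
    by (simp add: degree_map_poly degree_near_quadratic)
  obtain \<alpha> :: "nat \<Rightarrow> complex" where "map_poly of_int (near_quadratic n m ys) =
      smult (lead_coeff (map_poly of_int (near_quadratic n m ys))) (\<Prod>i<n. [:-\<alpha> i, 1:])"
    using complex_poly_split[OF deg] by blast
  thus ?thesis using that by (simp add: deg coeff_map_poly)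
qed

text \<open>
  At \<open>2 * \<i>\<close> the polynomial \<open>B * (x\<^sup>2 + 4)\<close> vanishes and has derivative \<open>4 * B * \<i>\<close>. The perturbation
  changes the value and the derivative by at most \<open>2 * m * 2 ^ (n + 1)\<close> and
  \<open>n * (2 * m) * 2 ^ (n + 1)\<close>, and \<open>4 * B\<close> is four times the last quantity. So \<open>root_near\<close> gives a
  root in the open unit disc about \<open>2 * \<i>\<close>, hence with imaginary part greater than 1.
\<close>
lemma near_quadratic_high_root:
  assumes split: "map_poly of_int (near_quadratic n m ys) =
       smult (of_int (coeff (near_quadratic n m ys) n)) (\<Prod>i<n. [:-\<alpha> i, 1:])"
  shows "\<exists>i<n. Im (\<alpha> i) > 1"
proof -
  define B where "B = real (n * 2 ^ (n + 2) * m)"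
  define E where "E = (map_poly of_int (Poly ys) :: complex poly)"
  define p where "p = (map_poly of_int (near_quadratic n m ys) :: complex poly)"
  have bound: "norm (poly q (2 * \<i>)) \<le> M * 2 ^ Suc n"
    if "degree q \<le> n" "\<And>k. k \<le> n \<Longrightarrow> norm (coeff q k) \<le> M" for q :: "complex poly" and M
  proof -
    have M: "M \<ge> 0" using that(2)[of 0] norm_ge_zero order_trans by blast
    have "norm (poly q (2 * \<i>)) \<le> (\<Sum>k\<le>degree q. norm (coeff q k * (2 * \<i>) ^ k))"
      unfolding poly_altdef by (rule norm_sum)
    also have "\<dots> \<le> (\<Sum>k\<le>degree q. M * 2 ^ k)"
      using that by (intro sum_mono) (simp add: norm_mult norm_power mult_right_mono)
    also have "\<dots> \<le> (\<Sum>k\<le>n. M * 2 ^ k)"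
      using that(1) M by (intro sum_mono2) auto
    also have "\<dots> = M * (2 ^ Suc n - 1)"
    proof -
      have "(\<Sum>k\<le>n. 2 ^ k) = (2 ^ Suc n - 1 :: real)" by (induction n) auto
      thus ?thesis by (simp only: sum_distrib_left[symmetric])
    qed
    also have "\<dots> \<le> M * 2 ^ Suc n" using M by (intro mult_left_mono) auto
    finally show ?thesis .
  qed
  have coeff_E: "coeff E k = (if k \<le> n then of_int (ys ! k) else 0)" for k
    by (simp add: E_def coeff_map_poly nth_default_def length_digits less_Suc_eq_le)
  have norm_E: "norm (coeff E k) \<le> 2 * real m" for k
    using digit_nth[of k] by (auto simp: coeff_E)
  have degE: "degree E \<le> n" by (rule degree_le) (simp add: coeff_E)
  have E: "norm (poly E (2 * \<i>)) \<le> 2 * real m * 2 ^ Suc n"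
    using degE norm_E by (rule bound)
  have E': "norm (poly (pderiv E) (2 * \<i>)) \<le> real n * (2 * real m) * 2 ^ Suc n"
  proof (rule bound)
    show "degree (pderiv E) \<le> n" using degE by (simp add: degree_pderiv)
    fix k
    show "norm (coeff (pderiv E) k) \<le> real n * (2 * real m)"
    proof (cases "Suc k \<le> n")
      case True
      thus ?thesis unfolding coeff_pderiv norm_mult
        using norm_E[of "Suc k"] by (intro mult_mono) (auto simp del: of_nat_Suc)
    next
      case False
      thus ?thesis by (simp add: coeff_pderiv coeff_E)
    qed
  qed
  have p: "p = [:4 * of_real B, 0, of_real B:] + E"
  proof (rule poly_eqI)
    fix k
    show "coeff p k = coeff ([:4 * of_real B, 0, of_real B:] + E) k"
      by (auto simp: p_def coeff_map_poly coeff_near_quadratic coeff_E length_digits B_def coeff_pCons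
          split: nat.splits)
  qed
  (* The quadratic part vanishes at 2 * \<i>, so only the perturbation contributes to the value. *)
  have val: "poly p (2 * \<i>) = poly E (2 * \<i>)"
    by (simp add: p)
  have der: "poly (pderiv p) (2 * \<i>) = of_real (4 * B) * \<i> + poly (pderiv E) (2 * \<i>)"
    by (simp add: p pderiv_add pderiv_pCons)
  have "4 * B = norm (of_real (4 * B) * \<i>)" by (simp only: norm_mult norm_of_real) (simp add: B_def)
  also have "\<dots> \<le> norm (poly (pderiv p) (2 * \<i>)) + norm (poly (pderiv E) (2 * \<i>))"
    using norm_triangle_ineq4[of "poly (pderiv p) (2 * \<i>)" "poly (pderiv E) (2 * \<i>)"] by (simp add: der)
  finally have lower: "norm (poly (pderiv p) (2 * \<i>)) \<ge> 4 * B - real n * (2 * real m) * 2 ^ Suc n"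
    using E' by linarith
  have "4 * B = 4 * (real n * (2 * real m) * 2 ^ Suc n)" by (simp add: B_def power_add)
  moreover have "real n * (2 * real m) * 2 ^ Suc n > 0" using n m by simp
  moreover have "real n * norm (poly p (2 * \<i>)) \<le> real n * (2 * real m * 2 ^ Suc n)"
    unfolding val by (intro mult_left_mono E) auto
  ultimately have "real n * norm (poly p (2 * \<i>)) < 1 * norm (poly (pderiv p) (2 * \<i>))"
    using lower by (simp only: mult.assoc)
  from root_near[OF split[folded p_def] this] obtain i where "i < n" "norm (2 * \<i> - \<alpha> i) < 1"
    by auto
  moreover have "\<bar>2 - Im (\<alpha> i)\<bar> \<le> norm (2 * \<i> - \<alpha> i)"
    using abs_Im_le_cmod[of "2 * \<i> - \<alpha> i"] by simp
  ultimately show ?thesis by (intro exI[of _ i]) auto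
qed

text \<open>
  The coefficients are at most \<open>height_factor n\<close> times the leading one, so the roots are bounded
  in terms of \<open>n\<close> alone, and only the leading coefficient contributes a power of \<open>m\<close>.
\<close>
lemma discr_near_quadratic_le:
  "norm (poly_discr (near_quadratic n m ys)) \<le>
     real (height_factor n * m) ^ (2 * n - 2) * ((2 * (real n * height_factor n)) ^ (n - 1)) ^ n"
proof -
  define l where "l = coeff (near_quadratic n m ys) n"
  obtain \<alpha> :: "nat \<Rightarrow> complex" where
    split: "map_poly of_int (near_quadratic n m ys) = smult (of_int l) (\<Prod>i<n. [:-\<alpha> i, 1:])"
    using near_quadratic_split unfolding l_def by blast
  have l: "l > int m" using lead_near_quadratic_ge by (simp add: l_def)
  have deg: "degree (map_poly of_int (near_quadratic n m ys) :: complex poly) = n"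
    by (simp add: degree_map_poly degree_near_quadratic)
  have "norm (\<alpha> i) \<le> real n * height_factor n" if "i < n" for i
  proof (rule poly_root_bound)
    show "poly (map_poly of_int (near_quadratic n m ys)) (\<alpha> i) = 0"
      using that by (auto simp: split poly_prod)
    show "degree (map_poly of_int (near_quadratic n m ys) :: complex poly) = n" by (rule deg)
    show "n \<ge> 1" using n by simp
    show "real (height_factor n) \<ge> 1" by (simp add: height_factor_def)
    fix k
    have "norm (coeff (map_poly of_int (near_quadratic n m ys)) k :: complex) =
        of_int \<bar>coeff (near_quadratic n m ys) k\<bar>"
      by (simp add: coeff_map_poly)
    also have "\<dots> \<le> of_int (int (height_factor n * m))"
      by (intro of_int_le_iff[THEN iffD2] abs_coeff_near_quadratic_le)
    also have "\<dots> \<le> height_factor n * of_int l"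
      using l by (simp add: mult_left_mono)
    finally show "norm (coeff (map_poly of_int (near_quadratic n m ys)) k :: complex) \<le>
        real (height_factor n) * norm (lead_coeff (map_poly of_int (near_quadratic n m ys)) :: complex)"
      using l by (simp add: deg coeff_map_poly flip: l_def)
  qed
  hence gaps: "root_gaps n \<alpha> \<le> ((2 * (real n * height_factor n)) ^ (n - 1)) ^ n"
    by (rule root_gaps_le)
  have "of_int \<bar>l\<bar> \<le> real_of_int (int (height_factor n * m))"
    unfolding l_def by (intro of_int_le_iff[THEN iffD2] abs_coeff_near_quadratic_le)
  hence "of_int \<bar>l\<bar> ^ (2 * n - 2) \<le> real (height_factor n * m) ^ (2 * n - 2)"
    by (intro power_mono) auto
  moreover have "l \<noteq> 0" using l by simp
  moreover have "root_gaps n \<alpha> \<ge> 0" by (simp add: root_gaps_def prod_nonneg)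
  ultimately show ?thesis
    using gaps by (subst norm_poly_discr[OF split]) (auto intro!: mult_mono)
qed

end

section \<open>Avoiding small discriminants by the choice of the constant term\<close>

lemma card_int_near_le: "card {y :: int. \<bar>of_int y + r\<bar> < (1 :: real)} \<le> 2"
proof -
  have "{y :: int. \<bar>of_int y + r\<bar> < 1} \<subseteq> {\<lfloor>- r\<rfloor>, \<lfloor>- r\<rfloor> + 1}"
  proof
    fix y :: int assume "y \<in> {y. \<bar>of_int y + r\<bar> < 1}"
    hence "of_int y < - r + 1" "of_int y > - r - 1" by auto
    hence "y < \<lfloor>- r\<rfloor> + 2" "y > \<lfloor>- r\<rfloor> - 1" by linarith+
    thus "y \<in> {\<lfloor>- r\<rfloor>, \<lfloor>- r\<rfloor> + 1}" by auto
  qed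
  hence "card {y :: int. \<bar>of_int y + r\<bar> < 1} \<le> card {\<lfloor>- r\<rfloor>, \<lfloor>- r\<rfloor> + 1}"
    by (rule card_mono[rotated]) simp
  thus ?thesis by simp
qed

lemma finite_int_near: "finite {y :: int. \<bar>of_int y + r\<bar> < (1 :: real)}"
proof (rule finite_subset)
  show "{y :: int. \<bar>of_int y + r\<bar> < 1} \<subseteq> {\<lfloor>- r\<rfloor> - 1..\<lfloor>- r\<rfloor> + 2}"
  proof
    fix y :: int assume "y \<in> {y. \<bar>of_int y + r\<bar> < 1}"
    hence "of_int y < - r + 1" "of_int y > - r - 1" by auto
    thus "y \<in> {\<lfloor>- r\<rfloor> - 1..\<lfloor>- r\<rfloor> + 2}" by (simp, linarith)
  qed
qed simp

text \<open>
  The conditions that depend on the choice of the constant term: after substitution of a matrix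
  with first column \<open>(a, c)\<close> the degree is still \<open>n\<close>, and the discriminant is not too small.
\<close>
definition good_digits :: "nat \<Rightarrow> nat \<Rightarrow> int \<Rightarrow> int \<Rightarrow> int list \<Rightarrow> bool" where
  "good_digits n m a c ys \<longleftrightarrow> binary_form n (near_quadratic n m ys) a c \<noteq> 0 \<and>
     1 \<le> norm (poly_discr (near_quadratic n m ys))"

text \<open>
  The constant term \<open>y\<close> shifts the values of the polynomial at its \<open>n - 1\<close> critical points, which
  themselves do not depend on \<open>y\<close>. Each of these values has real part in \<open>(-1, 1)\<close> for at most two \<open>y\<close>. If
  none is, the discriminant is at least 1 by \<open>root_gaps_critical_points\<close>. The value of the form at
  \<open>(a, c)\<close> vanishes for at most one more \<open>y\<close>.
\<close>
lemma card_good_constant_terms: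
  assumes n: "n \<ge> 2" and m: "m \<ge> 1" and xs: "xs \<in> digit_lists m n" and c: "c \<noteq> 0"
  shows "card {y \<in> {int m + 1..2 * int m}. \<not> good_digits n m a c (y # xs)} \<le> 2 * n - 1"
proof -
  define P where "P y = near_quadratic n m (y # xs)" for y
  define p where "p y = (map_poly of_int (P y) :: complex poly)" for y
  have dig: "y # xs \<in> digit_lists m (Suc n)" if "y \<in> {int m + 1..2 * int m}" for y
    using xs that by (auto simp: digit_lists_def)
  have P: "P y = P 0 + [:y:]" for y
    by (rule poly_eqI) (auto simp: P_def coeff_near_quadratic coeff_pCons split: nat.splits)
  have p: "p y = p 0 + [:of_int y:]" for y
    unfolding p_def by (subst P) (rule poly_eqI, auto simp: coeff_map_poly coeff_pCons split: nat.splits)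
  define l where "l = coeff (P 0) n"
  have lead: "coeff (P y) n = l" for y
    using n by (subst P) (simp add: l_def coeff_pCons split: nat.splits)
  (* Any admissible constant term serves to transfer degree and leading coefficient, which do not
     depend on it, to the polynomial with constant term 0. *)
  define m1 where "m1 = int m + 1"
  have m1: "m1 \<in> {int m + 1..2 * int m}" using m by (simp add: m1_def)
  have l: "l \<ge> 1"
    using lead_near_quadratic_ge[OF n m dig[OF m1]] lead[of m1] by (simp add: P_def)
  have degP: "degree (P y) = n" if "y \<in> {int m + 1..2 * int m}" for y
    using degree_near_quadratic[OF n m dig[OF that]] by (simp add: P_def)
  have der: "pderiv (p y) = pderiv (p 0)" for y
    by (subst p) (simp add: pderiv_add pderiv_pCons)
  have degp': "degree (pderiv (p 0)) = n - 1"
    using degP[OF m1] unfolding der[of m1, symmetric] by (simp add: degree_pderiv p_def degree_map_poly)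
  have "coeff (pderiv (p 0)) (n - 1) = of_nat n * of_int l"
    using n lead[of 0] by (simp add: coeff_pderiv p_def coeff_map_poly)
  with complex_poly_split[OF degp'] obtain \<beta> where
    \<beta>: "pderiv (p 0) = smult (of_nat n * of_int l) (\<Prod>k<n - 1. [:-\<beta> k, 1:])"
    unfolding degp' by metis
  have big: "norm (poly_discr (P y)) \<ge> 1"
    if y: "y \<in> {int m + 1..2 * int m}" and far: "\<And>k. k < n - 1 \<Longrightarrow> \<bar>of_int y + Re (poly (p 0) (\<beta> k))\<bar> \<ge> 1" for y
  proof -
    obtain \<alpha> :: "nat \<Rightarrow> complex" where split: "p y = smult (of_int l) (\<Prod>i<n. [:-\<alpha> i, 1:])"
      using near_quadratic_split[OF n m dig[OF y]] lead[of y] unfolding p_def P_def by metis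
    have "norm (of_int l :: complex) ^ (n - 1) * root_gaps n \<alpha> =
        real n ^ n * (\<Prod>k<n - 1. norm (poly (p y) (\<beta> k)))"
      by (rule root_gaps_critical_points[OF split _ trans[OF der \<beta>]]) (use l in simp)
    also have "\<dots> \<ge> 1 * (\<Prod>k<n - 1. 1)"
    proof (intro mult_mono prod_mono conjI)
      fix k assume "k \<in> {..<n - 1}"
      hence "1 \<le> \<bar>Re (poly (p y) (\<beta> k))\<bar>" using far by (subst p) (simp add: add.commute)
      also have "\<dots> \<le> norm (poly (p y) (\<beta> k))" by (rule abs_Re_le_cmod)
      finally show "1 \<le> norm (poly (p y) (\<beta> k))" .
    qed (use n in \<open>auto intro!: one_le_power prod_nonneg\<close>)
    finally have gaps: "1 \<le> real_of_int l ^ (n - 1) * root_gaps n \<alpha>" using l by simp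
    have "norm (poly_discr (P y)) = real_of_int l ^ (2 * n - 2) * root_gaps n \<alpha>"
      using norm_poly_discr[OF split[unfolded p_def]] l by simp
    also have "2 * n - 2 = (n - 1) + (n - 1)" by simp
    also have "real_of_int l ^ ((n - 1) + (n - 1)) * root_gaps n \<alpha> =
        real_of_int l ^ (n - 1) * (real_of_int l ^ (n - 1) * root_gaps n \<alpha>)"
      by (simp only: power_add mult.assoc)
    also have "\<dots> \<ge> 1 * 1" using l gaps by (intro mult_mono one_le_power) auto
    finally show ?thesis by simp
  qed
  have form: "binary_form n (P y) a c = binary_form n (P 0) a c + y * c ^ n" for y
  proof -
    have "binary_form n (P y) a c = (\<Sum>k\<le>n. coeff (P 0) k * a ^ k * c ^ (n - k) +
        (if k = 0 then y * c ^ n else 0))"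
      unfolding binary_form_def
      by (subst P, intro sum.cong) (auto simp: coeff_pCons algebra_simps split: nat.splits)
    thus ?thesis by (simp add: sum.distrib binary_form_def)
  qed
  have bad: "{y \<in> {int m + 1..2 * int m}. \<not> good_digits n m a c (y # xs)} \<subseteq>
      {y. binary_form n (P y) a c = 0} \<union>
      (\<Union>k<n - 1. {y. \<bar>of_int y + Re (poly (p 0) (\<beta> k))\<bar> < 1})" (is "?S \<subseteq> ?Z \<union> ?U")
  proof
    fix y assume y: "y \<in> ?S"
    show "y \<in> ?Z \<union> ?U"
    proof (rule ccontr)
      assume no: "y \<notin> ?Z \<union> ?U"
      hence "norm (poly_discr (P y)) \<ge> 1" using y by (intro big) force+
      thus False using y no by (auto simp: good_digits_def P_def)
    qed
  qed
  have Z: "finite ?Z \<and> card ?Z \<le> 1"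
  proof (cases "?Z = {}")
    case False
    then obtain z where z: "binary_form n (P z) a c = 0" by auto
    have "?Z = {z}"
    proof (intro equalityI subsetI)
      fix y assume "y \<in> ?Z"
      hence "binary_form n (P y) a c = 0" by simp
      hence "y * c ^ n = z * c ^ n" using z form[of y] form[of z] by linarith
      thus "y \<in> {z}" using c by simp
    qed (use z in auto)
    thus ?thesis by simp
  qed simp
  have U: "finite ?U" "card ?U \<le> (n - 1) * 2"
  proof -
    show "finite ?U" by (intro finite_UN_I finite_int_near) simp
    have "card ?U \<le> (\<Sum>k<n - 1. card {y :: int. \<bar>of_int y + Re (poly (p 0) (\<beta> k))\<bar> < 1})"
      by (rule card_UN_le) simp
    also have "\<dots> \<le> (\<Sum>k<n - 1. 2)" by (intro sum_mono card_int_near_le)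
    finally show "card ?U \<le> (n - 1) * 2" by simp
  qed
  have "card ?S \<le> card (?Z \<union> ?U)"
    using bad Z U(1) by (intro card_mono) auto
  also have "\<dots> \<le> card ?Z + card ?U" by (rule card_Un_le)
  also have "\<dots> \<le> 1 + (n - 1) * 2" using Z U(2) by (intro add_mono) auto
  finally show ?thesis using n by simp
qed

text \<open>
  The bound \<open>m \<ge> 4 * n\<close> makes the at most \<open>2 * n - 1\<close> bad constant terms at most half of all
  \<open>m\<close> choices.
\<close>
lemma card_good_digits:
  assumes n: "n \<ge> 2" and m: "m \<ge> 4 * n" and c: "c \<noteq> 0"
  shows "m ^ Suc n \<le> 2 * card {ys \<in> digit_lists m (Suc n). good_digits n m a c ys}"
proof -
  define A where "A xs = {y \<in> {int m + 1..2 * int m}. good_digits n m a c (y # xs)}" for xs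
  have finA: "finite (A xs)" for xs
    unfolding A_def by (rule finite_subset[of _ "{int m + 1..2 * int m}"]) auto
  have A: "m \<le> 2 * card (A xs)" if "xs \<in> digit_lists m n" for xs
  proof -
    let ?N = "{y \<in> {int m + 1..2 * int m}. \<not> good_digits n m a c (y # xs)}"
    have "finite ?N" by (rule finite_subset[of _ "{int m + 1..2 * int m}"]) auto
    hence "card (A xs) + card ?N = card (A xs \<union> ?N)"
      using finA by (intro card_Un_disjoint[symmetric]) (auto simp: A_def)
    also have "A xs \<union> ?N = {int m + 1..2 * int m}" by (auto simp: A_def)
    also have "card \<dots> = m" by simp
    finally show ?thesis
      using card_good_constant_terms[OF n _ that c, of a] m n by linarith
  qed
  have "m ^ Suc n = (\<Sum>xs\<in>digit_lists m n. m)" by (simp add: card_digit_lists)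
  also have "\<dots> \<le> (\<Sum>xs\<in>digit_lists m n. 2 * card (A xs))" by (intro sum_mono A)
  also have "\<dots> = 2 * card (SIGMA xs:digit_lists m n. A xs)"
    by (simp add: sum_distrib_left finite_digit_lists finA)
  also have "card (SIGMA xs:digit_lists m n. A xs) =
      card ((\<lambda>(xs, y). y # xs) ` (SIGMA xs:digit_lists m n. A xs))"
    by (rule card_image[symmetric]) (auto simp: inj_on_def)
  also have "\<dots> \<le> card {ys \<in> digit_lists m (Suc n). good_digits n m a c ys}"
  proof (rule card_mono)
    show "finite {ys \<in> digit_lists m (Suc n). good_digits n m a c ys}"
      by (rule finite_subset[OF _ finite_digit_lists]) auto
  qed (auto simp: A_def digit_lists_def)
  finally show ?thesis by simp
qed

section \<open>Counting polynomials of small discriminant\<close>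

lemma card_le_fibres:
  assumes "finite S" and "\<And>y. y \<in> f ` S \<Longrightarrow> card {x \<in> S. f x = y} \<le> k"
  shows "card S \<le> k * card (f ` S)"
proof -
  have "S = (\<Union>y\<in>f ` S. {x \<in> S. f x = y})" by auto
  hence "card S \<le> (\<Sum>y\<in>f ` S. card {x \<in> S. f x = y})"
    using card_UN_le[of "f ` S" "\<lambda>y. {x \<in> S. f x = y}"] assms(1) by simp
  also have "\<dots> \<le> (\<Sum>y\<in>f ` S. k)" by (intro sum_mono assms)
  finally show ?thesis by (simp add: mult.commute)
qed

text \<open>
  The constant, depending on \<open>n\<close> only, in front of \<open>m ^ (2 * n - 2)\<close> in
  \<open>discr_near_quadratic_le\<close>.
\<close>
definition discr_factor :: "nat \<Rightarrow> real" where
  "discr_factor n = real (height_factor n) ^ (2 * n - 2) * ((2 * (real n * height_factor n)) ^ (n - 1)) ^ n"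

text \<open>
  Fix a unimodular matrix for each coprime bottom row in \<open>{1..N}\<^sup>2\<close> and consider all pairs of such a
  matrix and a good perturbation; there are at least \<open>N\<^sup>2 / 4 * m ^ (n + 1) / 2\<close> of them. The
  substitution maps a pair into the set that is to be counted. Choosing for each pair in the fibre
  over \<open>G\<close> the root of \<open>G\<close> that comes from the high root of the perturbed quadratic embeds the
  fibre into the roots of \<open>G\<close>, so fibres have at most \<open>n\<close> elements.
\<close>
lemma card_discr_polys_ge:
  assumes n: "n \<ge> 2" and m: "m \<ge> 4 * n"
    and height: "real ((n + 1) * (height_factor n * m) * (2 * N) ^ n) \<le> Q"
    and discr: "discr_factor n * real m ^ (2 * n - 2) \<le> \<gamma> * Q powr (2 * real n - 2 - 2 * v)"
  shows "real N ^ 2 * real m ^ Suc n \<le> 8 * real n * card (discr_polys n \<gamma> Q v)"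
proof -
  have "\<forall>cd\<in>coprime_pairs N. \<exists>ab. fst ab * int (snd cd) - snd ab * int (fst cd) = 1 \<and>
      \<bar>fst ab\<bar> \<le> int (fst cd) \<and> \<bar>snd ab\<bar> \<le> int (snd cd)"
    using bounded_bezout by (fastforce simp: coprime_pairs_def)
  then obtain h where h: "\<And>cd. cd \<in> coprime_pairs N \<Longrightarrow>
      fst (h cd) * int (snd cd) - snd (h cd) * int (fst cd) = 1 \<and>
      \<bar>fst (h cd)\<bar> \<le> int (fst cd) \<and> \<bar>snd (h cd)\<bar> \<le> int (snd cd)"
    by metis
  define Y where "Y cd = {ys \<in> digit_lists m (Suc n).
      good_digits n m (fst (h cd)) (int (fst cd)) ys}" for cd
  define S where "S = Sigma (coprime_pairs N) Y"
  define f where "f x = subst_form n (fst (h (fst x))) (snd (h (fst x)))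
      (int (fst (fst x))) (int (snd (fst x))) (near_quadratic n m (snd x))"
    for x :: "(nat \<times> nat) \<times> int list"
  have m1: "m \<ge> 1" using m n by simp
  have finY: "finite (Y cd)" for cd by (simp add: Y_def finite_digit_lists)
  have finS: "finite S" by (simp add: S_def finite_coprime_pairs finY)
  have S: "fst x \<in> coprime_pairs N" "snd x \<in> digit_lists m (Suc n)"
      "good_digits n m (fst (h (fst x))) (int (fst (fst x))) (snd x)" if "x \<in> S" for x
    using that by (auto simp: S_def Y_def)
  have pos: "fst cd \<ge> 1" "snd cd \<ge> 1" "fst cd \<le> N" "snd cd \<le> N" "coprime (fst cd) (snd cd)"
    if "cd \<in> coprime_pairs N" for cd
    using that by (auto simp: coprime_pairs_def)
  have image: "degree (f x) = n \<and> norm (poly_discr (f x)) = norm (poly_discr (near_quadratic n m (snd x))) \<and>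
      (\<exists>w. poly (map_poly of_int (f x)) w = 0 \<and>
        norm (of_nat (fst (fst x)) * w + of_nat (snd (fst x))) ^ 2 < Im w)"
    if x: "x \<in> S" for x
  proof -
    define l where "l = coeff (near_quadratic n m (snd x)) n"
    obtain \<alpha> :: "nat \<Rightarrow> complex" where
      split: "map_poly of_int (near_quadratic n m (snd x)) = smult (of_int l) (\<Prod>i<n. [:-\<alpha> i, 1:])"
      using near_quadratic_split[OF n m1 S(2)[OF x]] unfolding l_def by metis
    have l: "l \<noteq> 0" using lead_near_quadratic_ge[OF n m1 S(2)[OF x]] by (simp add: l_def)
    have det: "fst (h (fst x)) * int (snd (fst x)) - snd (h (fst x)) * int (fst (fst x)) = 1"
      using h[OF S(1)[OF x]] by blast
    have lead: "binary_form n (near_quadratic n m (snd x)) (fst (h (fst x))) (int (fst (fst x))) \<noteq> 0"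
      using S(3)[OF x] by (simp add: good_digits_def)
    have n1: "1 \<le> n" using n by simp
    note image = subst_form_int[OF split l n1 det lead, folded f_def]
    obtain i where i: "i < n" "Im (\<alpha> i) > 1"
      using near_quadratic_high_root[OF n m1 S(2)[OF x] split[unfolded l_def]] by blast
    define w where "w = (\<alpha> i * of_int (int (snd (fst x))) - of_int (snd (h (fst x)))) /
        (of_int (fst (h (fst x))) - \<alpha> i * of_int (int (fst (fst x))))"
    have "poly (map_poly of_int (f x)) w = 0"
      using i(1) unfolding image(2) w_def by (auto simp: poly_prod intro!: prod_zero)
    moreover have "norm (of_nat (fst (fst x)) * w + of_nat (snd (fst x))) ^ 2 < Im w"
      unfolding w_def by (rule moebius_high_root[OF i(2) det pos(1)[OF S(1)[OF x]]])
    ultimately show ?thesis using image(1,3) by blast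
  qed
  have "f ` S \<subseteq> discr_polys n \<gamma> Q v"
  proof
    fix G assume "G \<in> f ` S"
    then obtain x where x: "x \<in> S" "G = f x" by auto
    note ab = h[OF S(1)[OF x(1)]] and cd = pos[OF S(1)[OF x(1)]]
    have "\<bar>coeff G i\<bar> \<le> (int n + 1) * int (height_factor n * m) * (2 * int N) ^ n" for i
      unfolding x(2) f_def
      by (rule abs_coeff_subst_form_le[OF abs_coeff_near_quadratic_le[OF n m1 S(2)[OF x(1)]]])
         (use ab cd in auto)
    hence "height G \<le> (int n + 1) * int (height_factor n * m) * (2 * int N) ^ n"
      unfolding height_def by (intro Max.boundedI) auto
    also have "\<dots> = int ((n + 1) * (height_factor n * m) * (2 * N) ^ n)" by (simp add: algebra_simps)
    finally have "real_of_int (height G) \<le> Q" using height by linarith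
    moreover have "norm (poly_discr G) \<ge> 1"
      using S(3)[OF x(1)] image[OF x(1)] by (simp add: x(2) good_digits_def)
    moreover have "norm (poly_discr G) \<le> \<gamma> * Q powr (2 * real n - 2 - 2 * v)"
    proof -
      have "norm (poly_discr G) \<le> discr_factor n * real m ^ (2 * n - 2)"
        using discr_near_quadratic_le[OF n m1 S(2)[OF x(1)]] image[OF x(1)]
        by (simp add: x(2) discr_factor_def power_mult_distrib mult_ac)
      thus ?thesis using discr by linarith
    qed
    ultimately show "G \<in> discr_polys n \<gamma> Q v"
      using image[OF x(1)] by (simp add: discr_polys_def int_polys_def x(2))
  qed
  hence card_image: "card (f ` S) \<le> card (discr_polys n \<gamma> Q v)"
    by (intro card_mono finite_discr_polys)
  have fibre: "card {x \<in> S. f x = G} \<le> n" if G: "G \<in> f ` S" for G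
  proof -
    define R where "R = {w :: complex. poly (map_poly of_int G) w = 0}"
    have deg: "degree (map_poly of_int G :: complex poly) = n"
      using G image by (auto simp: degree_map_poly)
    hence nz: "map_poly of_int G \<noteq> (0 :: complex poly)" using n by auto
    have R: "finite R" "card R \<le> n"
      using poly_roots_finite[OF nz] card_poly_roots_bound[OF nz] by (auto simp: R_def deg)
    have "\<forall>x\<in>{x \<in> S. f x = G}. \<exists>w. w \<in> R \<and>
        norm (of_nat (fst (fst x)) * w + of_nat (snd (fst x))) ^ 2 < Im w"
    proof
      fix x assume "x \<in> {x \<in> S. f x = G}"
      hence x: "x \<in> S" and G_eq: "G = f x" by auto
      show "\<exists>w. w \<in> R \<and> norm (of_nat (fst (fst x)) * w + of_nat (snd (fst x))) ^ 2 < Im w"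
        using image[OF x] unfolding R_def G_eq mem_Collect_eq by blast
    qed
    from bchoice[OF this] obtain g where g: "\<And>x. x \<in> {x \<in> S. f x = G} \<Longrightarrow> g x \<in> R \<and>
        norm (of_nat (fst (fst x)) * g x + of_nat (snd (fst x))) ^ 2 < Im (g x)"
      by blast
    have "inj_on g {x \<in> S. f x = G}"
    proof (rule inj_onI)
      fix x y assume x: "x \<in> {x \<in> S. f x = G}" and y: "y \<in> {x \<in> S. f x = G}" and eq: "g x = g y"
      have xS: "x \<in> S" and yS: "y \<in> S" using x y by auto
      have "fst (fst x) = fst (fst y) \<and> snd (fst x) = snd (fst y)"
        using g[OF x] g[OF y] pos(5)[OF S(1)[OF xS]] pos(5)[OF S(1)[OF yS]]
        unfolding eq by (intro high_orbit_point_unique[of _ "g y"]) auto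
      hence cd: "fst x = fst y" by (simp add: prod_eq_iff)
      have "f x = f y" using x y by simp
      hence "near_quadratic n m (snd x) = near_quadratic n m (snd y)"
        unfolding f_def cd
      proof (rule subst_form_inj_int)
        show "fst (h (fst y)) * int (snd (fst y)) - snd (h (fst y)) * int (fst (fst y)) = 1"
          using h[OF S(1)[OF yS]] by blast
      qed (simp_all only: degree_near_quadratic[OF n m1 S(2)] xS yS order_refl)
      hence "snd x = snd y"
        by (rule near_quadratic_inj) (use S(2)[OF xS] S(2)[OF yS] in \<open>simp add: digit_lists_def\<close>)
      thus "x = y" using cd by (simp add: prod_eq_iff)
    qed
    hence "card {x \<in> S. f x = G} \<le> card R"
      using g R(1) by (intro card_inj_on_le[of g]) auto
    thus ?thesis using R(2) by linarith
  qed
  have "card (coprime_pairs N) * m ^ Suc n = (\<Sum>cd\<in>coprime_pairs N. m ^ Suc n)" by simp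
  also have "\<dots> \<le> (\<Sum>cd\<in>coprime_pairs N. 2 * card (Y cd))"
  proof (intro sum_mono)
    fix cd assume "cd \<in> coprime_pairs N"
    hence "int (fst cd) \<noteq> 0" using pos(1) by fastforce
    thus "m ^ Suc n \<le> 2 * card (Y cd)"
      unfolding Y_def by (rule card_good_digits[OF n m])
  qed
  also have "\<dots> = 2 * card S"
    by (simp add: S_def sum_distrib_left finite_coprime_pairs finY)
  also have "\<dots> \<le> 2 * (n * card (f ` S))"
    by (intro mult_left_mono card_le_fibres finS fibre) auto
  also have "\<dots> \<le> 2 * (n * card (discr_polys n \<gamma> Q v))"
    by (intro mult_left_mono card_image) auto
  finally have "real (card (coprime_pairs N) * m ^ Suc n) \<le> real (2 * (n * card (discr_polys n \<gamma> Q v)))"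
    by (simp only: of_nat_le_iff)
  moreover have "(real N)\<^sup>2 / 4 * real m ^ Suc n \<le> real (card (coprime_pairs N)) * real m ^ Suc n"
    by (intro mult_right_mono card_coprime_pairs) auto
  ultimately show ?thesis by simp
qed

theorem theorem1:
  fixes n :: nat
  assumes "n \<ge> 2"
  shows "\<exists>\<gamma> C Q\<^sub>0 :: real. \<gamma> > 0 \<and> C > 0 \<and> Q\<^sub>0 > 1 \<and>
           (\<forall>Q v :: real. Q \<ge> Q\<^sub>0 \<longrightarrow> 0 \<le> v \<longrightarrow> v \<le> real n - 1 \<longrightarrow>
              real (card (discr_polys n \<gamma> Q v))
                \<ge> C * Q powr (real n + 1 - (real n + 2) / real n * v))"
proof -
  (* K is the loss in height: a substitution of size N turns digits of size m into a polynomial of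
     height at most K * m * N ^ n. The factor \<theta> makes the matrices smaller by a constant, which
     guarantees m \<ge> 4 * n even for v = n - 1, where Q / T ^ n is bounded. *)
  define K where "K = real ((n + 1) * height_factor n * 2 ^ n)"
  define \<theta> where "\<theta> = 2 * K * (4 * real n)"
  define \<gamma> where "\<gamma> = discr_factor n * (\<theta> ^ n / K) ^ (2 * n - 2)"
  define C where "C = 1 / (8 * real n * (\<theta>\<^sup>2 * (2 * K * 2 ^ n) ^ Suc n))"
  have "1 * 1 * 1 \<le> (n + 1) * height_factor n * 2 ^ n"
    by (intro mult_mono) (auto simp: height_factor_def)
  hence K: "K \<ge> 1" unfolding K_def by linarith
  have "1 * 1 \<le> K * (4 * real n)" using K assms by (intro mult_mono) auto
  hence Kn: "K * (4 * real n) \<ge> 1" and \<theta>: "\<theta> \<ge> 2" by (simp_all add: \<theta>_def)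
  have "height_factor n > 0" by (simp add: height_factor_def)
  hence "discr_factor n > 0"
    using assms by (auto simp: discr_factor_def intro!: mult_pos_pos zero_less_power)
  hence \<gamma>: "\<gamma> > 0" using K \<theta> by (auto simp: \<gamma>_def intro!: mult_pos_pos zero_less_power divide_pos_pos)
  have C: "C > 0" using K \<theta> assms by (auto simp: C_def intro!: mult_pos_pos zero_less_power divide_pos_pos)
  have main: "C * Q powr (real n + 1 - (real n + 2) / real n * v) \<le> real (card (discr_polys n \<gamma> Q v))"
    if Q: "Q \<ge> K * (4 * real n) + 1" and v: "0 \<le> v" "v \<le> real n - 1" for Q v
  proof -
    have Q1: "Q > 1" using Q Kn by linarith
    have n1: "real n - 1 > 0" using assms by simp
    define T where "T = Q powr (v / (real n * (real n - 1)))"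
    define X where "X = Q powr (1 - v / (real n - 1))"
    have T1: "T \<ge> 1" unfolding T_def using Q1 v n1 by (intro ge_one_powr_ge_zero divide_nonneg_nonneg) auto
    have X0: "X > 0" using Q1 by (simp add: X_def)
    have Tn: "T ^ n = Q powr (v / (real n - 1))"
      using Q1 assms by (simp add: T_def powr_power)
    have TX: "T ^ n * X = Q"
      using Q1 by (simp add: Tn X_def flip: powr_add)
    have Tn_le: "T ^ n \<le> Q"
    proof -
      have "Q powr (v / (real n - 1)) \<le> Q powr 1"
        using Q1 v n1 by (intro powr_mono) (auto simp: divide_le_eq_1)
      thus ?thesis using Q1 by (simp add: Tn)
    qed
    (* Rounding up keeps N positive when T / \<theta> is small; N stays between T / \<theta> and 2 * T. *)
    define N where "N = nat \<lceil>T / \<theta>\<rceil>"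
    have "T / \<theta> > 0" using T1 \<theta> by simp
    hence N1: "N \<ge> 1" and N_ge: "real N \<ge> T / \<theta>" and N_le: "real N \<le> T / \<theta> + 1"
      unfolding N_def by linarith+
    define q where "q = Q / (K * real N ^ n)"
    have KN: "K * real N ^ n > 0" using K N1 by (intro mult_pos_pos zero_less_power) auto
    have q_ge: "q \<ge> 4 * real n"
    proof -
      have "4 * real n * (K * real N ^ n) \<le> Q"
      proof (cases "T \<le> \<theta>")
        case True
        hence "T / \<theta> \<le> 1" using \<theta> by simp
        hence "N = 1" using N1 by (simp add: N_def) linarith
        thus ?thesis using Q by (simp add: mult_ac)
      next
        case False
        hence "T / \<theta> \<ge> 1" using \<theta> by simp
        hence "real N \<le> 2 * T / \<theta>" using N_le by linarith
        also have "\<dots> = T / (K * (4 * real n))" by (simp add: \<theta>_def)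
        finally have "real N ^ n \<le> (T / (K * (4 * real n))) ^ n" by (rule power_mono) simp
        also have "\<dots> = T ^ n / (K * (4 * real n)) ^ n" by (rule power_divide)
        also have "\<dots> \<le> Q / (K * (4 * real n)) ^ 1"
          using Tn_le Q1 Kn assms by (intro frac_le power_increasing) auto
        finally show ?thesis using Kn K assms by (simp add: field_simps)
      qed
      thus ?thesis using KN by (simp add: q_def pos_le_divide_eq)
    qed
    define m where "m = nat \<lfloor>q\<rfloor>"
    have m: "m \<ge> 4 * n" using q_ge unfolding m_def by linarith
    have m_le: "real m \<le> q" using q_ge by (simp add: m_def)
    have m_ge: "real m \<ge> q / 2" using q_ge assms unfolding m_def by linarith
    have height: "real ((n + 1) * (height_factor n * m) * (2 * N) ^ n) \<le> Q"
    proof -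
      have "real ((n + 1) * (height_factor n * m) * (2 * N) ^ n) = real m * (K * real N ^ n)"
        by (simp add: K_def power_mult_distrib mult_ac)
      also have "\<dots> \<le> q * (K * real N ^ n)" using m_le KN by (intro mult_right_mono) auto
      also have "\<dots> = Q"
      proof -
        have "Q / D * D = Q" if "D > 0" for D :: real using that by simp
        from this[OF KN] show ?thesis by (simp only: q_def)
      qed
      finally show ?thesis .
    qed
    have "q \<le> Q / (K * (T / \<theta>) ^ n)"
      unfolding q_def using N_ge T1 \<theta> K Q1
      by (intro divide_left_mono mult_left_mono power_mono mult_pos_pos zero_less_power) (use N1 in auto)
    also have "\<dots> = \<theta> ^ n / K * X"
      using T1 \<theta> K by (simp add: TX[symmetric] power_divide field_simps)
    finally have mX: "real m \<le> \<theta> ^ n / K * X" using m_le by linarith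
    have discr: "discr_factor n * real m ^ (2 * n - 2) \<le> \<gamma> * Q powr (2 * real n - 2 - 2 * v)"
    proof -
      have "real m ^ (2 * n - 2) \<le> (\<theta> ^ n / K * X) ^ (2 * n - 2)" using mX by (rule power_mono) simp
      also have "\<dots> = (\<theta> ^ n / K) ^ (2 * n - 2) * X ^ (2 * n - 2)" by (rule power_mult_distrib)
      also have "X ^ (2 * n - 2) = Q powr (2 * real n - 2 - 2 * v)"
      proof -
        have "real (2 * n - 2) * (1 - v / (real n - 1)) = 2 * real n - 2 - 2 * v"
          using n1 assms by (simp add: of_nat_diff field_simps)
        thus ?thesis using Q1 by (simp add: X_def powr_power mult.commute)
      qed
      finally show ?thesis
        using \<open>discr_factor n > 0\<close> unfolding \<gamma>_def by (simp add: mult.assoc)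
    qed
    have "real N \<le> 2 * T"
    proof -
      have "T / \<theta> \<le> T / 1" using T1 \<theta> by (intro divide_left_mono) auto
      thus ?thesis using N_le T1 by linarith
    qed
    hence "Q / (K * (2 * T) ^ n) \<le> q"
      unfolding q_def using T1 K Q1 N1
      by (intro divide_left_mono mult_left_mono power_mono mult_pos_pos zero_less_power) auto
    moreover have "Q / (K * (2 * T) ^ n) = X / (K * 2 ^ n)"
      using T1 K by (simp add: TX[symmetric] power_mult_distrib field_simps)
    ultimately have m_lower: "real m \<ge> X / (2 * K * 2 ^ n)"
      using m_ge by (simp add: field_simps)
    (* This identity of exponents is where the exponent of the theorem comes from. *)
    have "T\<^sup>2 * X ^ Suc n = Q powr (real n + 1 - (real n + 2) / real n * v)"
    proof -
      have "T\<^sup>2 * X ^ Suc n =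
          Q powr (2 * (v / (real n * (real n - 1))) + real (Suc n) * (1 - v / (real n - 1)))"
        unfolding powr_add using Q1 by (simp add: T_def X_def powr_power mult_ac del: power_Suc)
      also have "2 * (v / (real n * (real n - 1))) + real (Suc n) * (1 - v / (real n - 1)) =
          real n + 1 - (real n + 2) / real n * v"
      proof -
        have "real n \<noteq> 0" "real n - 1 \<noteq> 0" using n1 assms by auto
        thus ?thesis by (simp add: divide_simps) (simp add: algebra_simps)
      qed
      finally show ?thesis .
    qed
    hence "C * Q powr (real n + 1 - (real n + 2) / real n * v) * (8 * real n) =
        (T / \<theta>)\<^sup>2 * (X / (2 * K * 2 ^ n)) ^ Suc n"
      using assms by (simp add: C_def power_divide del: power_Suc)
    also have "\<dots> \<le> real N ^ 2 * real m ^ Suc n"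
      using N_ge m_lower T1 \<theta> X0 K by (intro mult_mono power_mono) auto
    also have "\<dots> \<le> 8 * real n * card (discr_polys n \<gamma> Q v)"
      by (rule card_discr_polys_ge[OF assms m height discr])
    finally show ?thesis using assms by (simp add: mult.commute)
  qed
  show ?thesis
    using \<gamma> C Kn main by (intro exI[of _ \<gamma>] exI[of _ C] exI[of _ "K * (4 * real n) + 1"]) auto
qed

end
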